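(* Let $k\ge 2$ and let $\mathfrak{T}$ be a $k$-uniform supertree on $n$ vertices with $m\ge 1$ edges. Then $$\rho(\mathcal{A}(\mathfrak{T}))\leq m^{1/k},$$ $$\rho(\mathcal{Q}(\mathfrak{T}))\leq 1+\alpha^*,$$ where $\alpha^*\in (m-1, m]$ is the largest real root of $x^k-(m-1)x^{k-1}-m=0$, and $$\rho(\mathcal{Q}^*(\mathfrak{T}))\leq (m^{1/(k-1)}+k-1)^{k-1}.$$ Moreover, for each one of these three inequalities, equality holds if and only if $\mathfrak{T}$ is (isomorphic to) the hyperstar $\mathcal{S}_{n,k}$.
   Context: Hypergraphs. A $k$-uniform hypergraph ($k\ge2$) $G=(V,E)$ has finite vertex set $V=[n]=\{1,\dots,n\}$ and a set $E$ of $k$-element subsets of $V$ (the edges; no repeated edges). The degree $d_i$ of a vertex $i$ is the number of edges containing $i$. A path of length $q$ is a sequence $v_1,e_1,v_2,\dots,v_q,e_q,v_{q+1}$ with distinct vertices $v_1,\dots,v_{q+1}$, distinct edges $e_1,\dots,e_q$, and $v_r,v_{r+1}\in e_r$ for all $r$. A cycle of length $q>1$ is such a sequence in which $v_1,\dots,v_q$ are distinct, $e_1,\dots,e_q$ are distinct and $v_{q+1}=v_1$. $G$ is connected if any two vertices are joined by a path, acyclic if it has no cycle. A supertree is a connected acyclic hypergraph. The hyperstar $\mathcal{S}_{n,k}$ (where $n=m(k-1)+1$) is the $k$-uniform hypergraph with $m$ edges whose vertex set has a partition $V=V_0\cup V_1\cup\cdots\cup V_m$ with $|V_0|=1$, $|V_1|=\cdots=|V_m|=k-1$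 and $E=\{V_0\cup V_i : i\in[m]\}$. Tensors. For a real order-$k$ dimension-$n$ tensor $\mathcal{T}=(\mathcal{T}_{i_1\cdots i_k})$ and $x\in\mathbb{C}^n$, $\mathcal{T}x\in\mathbb{C}^n$ is defined by $(\mathcal{T}x)_i=\sum_{i_2,\dots,i_k=1}^n\mathcal{T}_{ii_2\cdots i_k}x_{i_2}\cdots x_{i_k}$. A number $\lambda\in\mathbb{C}$ is an eigenvalue of $\mathcal{T}$ with eigenvector $0\ne x\in\mathbb{C}^n$ if $(\mathcal{T}x)_i=\lambda x_i^{k-1}$ for all $i$. The spectral radius $\rho(\mathcal{T})$ is the maximum modulus of an eigenvalue of $\mathcal{T}$. For a $k$-uniform hypergraph $G$: the adjacency tensor $\mathcal{A}(G)$ has entries $a_{i_1\cdots i_k}=\frac1{(k-1)!}$ if $\{i_1,\dots,i_k\}\in E$ and $0$ otherwise; the signless Laplacian tensor is $\mathcal{Q}(G)=\mathcal{D}(G)+\mathcal{A}(G)$ where $\mathcal{D}(G)$ is the diagonal tensor with $\mathcal{D}_{i\cdots i}=d_i$; the incidence $Q$-tensor $\mathcal{Q}^*(G)$ has $(i_1,\dots,i_k)$-entry equal to the number of edges $e$ with $i_t\in e$ for all $t=1,\dots,k$ (indices may repeat). *)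

theory Defs
  imports Complex_Main "HOL-Library.Disjoint_Sets"
begin

text \<open>
  A hypergraph on the vertex set \<open>[n] = {1..n}\<close> is given by \<open>n\<close> and its set \<open>E\<close> of edges.
\<close>

definition uniform_hypergraph :: "nat \<Rightarrow> nat \<Rightarrow> nat set set \<Rightarrow> bool" where
  "uniform_hypergraph n k E \<longleftrightarrow> (\<forall>e\<in>E. e \<subseteq> {1..n} \<and> card e = k)"

definition degree :: "nat set set \<Rightarrow> nat \<Rightarrow> nat" where
  "degree E i = card {e \<in> E. i \<in> e}"

text \<open>
  A path or cycle \<open>v\<^sub>1, e\<^sub>1, v\<^sub>2, \<dots>, e\<^sub>q, v\<^bsub>q+1\<^esub>\<close> is given by its list \<open>vs\<close> of \<open>q + 1\<close> vertices
  and its list \<open>es\<close> of \<open>q\<close> edges, both indexed from \<open>0\<close>.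
\<close>

definition hyperpath :: "nat \<Rightarrow> nat set set \<Rightarrow> nat \<Rightarrow> nat list \<Rightarrow> nat set list \<Rightarrow> bool" where
  "hyperpath n E q vs es \<longleftrightarrow>
     length vs = q + 1 \<and> length es = q \<and> set vs \<subseteq> {1..n} \<and> set es \<subseteq> E \<and>
     distinct vs \<and> distinct es \<and>
     (\<forall>r<q. vs ! r \<in> es ! r \<and> vs ! (r + 1) \<in> es ! r)"

definition hypercycle :: "nat \<Rightarrow> nat set set \<Rightarrow> nat \<Rightarrow> nat list \<Rightarrow> nat set list \<Rightarrow> bool" where
  "hypercycle n E q vs es \<longleftrightarrow>
     q > 1 \<and> length vs = q + 1 \<and> length es = q \<and> set vs \<subseteq> {1..n} \<and> set es \<subseteq> E \<and>
     distinct (take q vs) \<and> distinct es \<and> vs ! q = vs ! 0 \<and>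
     (\<forall>r<q. vs ! r \<in> es ! r \<and> vs ! (r + 1) \<in> es ! r)"

definition hyper_connected :: "nat \<Rightarrow> nat set set \<Rightarrow> bool" where
  "hyper_connected n E \<longleftrightarrow>
     (\<forall>u\<in>{1..n}. \<forall>v\<in>{1..n}. \<exists>q vs es. hyperpath n E q vs es \<and> vs ! 0 = u \<and> vs ! q = v)"

definition hyper_acyclic :: "nat \<Rightarrow> nat set set \<Rightarrow> bool" where
  "hyper_acyclic n E \<longleftrightarrow> \<not> (\<exists>q vs es. hypercycle n E q vs es)"

definition supertree :: "nat \<Rightarrow> nat \<Rightarrow> nat set set \<Rightarrow> bool" where
  "supertree n k E \<longleftrightarrow>
     uniform_hypergraph n k E \<and> hyper_connected n E \<and> hyper_acyclic n E"

definition hyperstar :: "nat \<Rightarrow> nat \<Rightarrow> nat \<Rightarrow> nat set set \<Rightarrow> bool" where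
  "hyperstar n k m E \<longleftrightarrow>
     n = m * (k - 1) + 1 \<and> uniform_hypergraph n k E \<and> card E = m \<and>
     (\<exists>P :: nat \<Rightarrow> nat set.
        (\<Union>i\<in>{0..m}. P i) = {1..n} \<and> disjoint_family_on P {0..m} \<and>
        card (P 0) = 1 \<and> (\<forall>i\<in>{1..m}. card (P i) = k - 1) \<and>
        E = {P 0 \<union> P i | i. i \<in> {1..m}})"

definition hypergraph_isomorphic :: "nat \<Rightarrow> nat set set \<Rightarrow> nat \<Rightarrow> nat set set \<Rightarrow> bool" where
  "hypergraph_isomorphic n E n' E' \<longleftrightarrow>
     (\<exists>f. bij_betw f {1..n} {1..n'} \<and> E' = (\<lambda>e. f ` e) ` E)"

text \<open>
  A real tensor of order \<open>k\<close> and dimension \<open>n\<close> is a function on index lists of length \<open>k\<close> with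
  entries in \<open>{1..n}\<close>; its values on other lists are never used.  Likewise a vector of
  \<open>\<complex>\<^sup>n\<close> is a function on \<open>{1..n}\<close> whose values elsewhere are never used.
\<close>

type_synonym tensor = "nat list \<Rightarrow> real"

definition tensor_apply ::
    "nat \<Rightarrow> nat \<Rightarrow> tensor \<Rightarrow> (nat \<Rightarrow> complex) \<Rightarrow> nat \<Rightarrow> complex" where
  "tensor_apply k n T x i =
     (\<Sum>js \<in> {js. length js = k - 1 \<and> set js \<subseteq> {1..n}}. of_real (T (i # js)) * (\<Prod>j\<leftarrow>js. x j))"

definition tensor_eigenvalue :: "nat \<Rightarrow> nat \<Rightarrow> tensor \<Rightarrow> complex \<Rightarrow> bool" where
  "tensor_eigenvalue k n T c \<longleftrightarrow>
     (\<exists>x. (\<exists>i\<in>{1..n}. x i \<noteq> 0) \<and> (\<forall>i\<in>{1..n}. tensor_apply k n T x i = c * x i ^ (k - 1)))"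

definition spectral_radius :: "nat \<Rightarrow> nat \<Rightarrow> tensor \<Rightarrow> real" where
  "spectral_radius k n T = (GREATEST r. \<exists>c. tensor_eigenvalue k n T c \<and> r = cmod c)"

definition adjacency_tensor :: "nat \<Rightarrow> nat set set \<Rightarrow> tensor" where
  "adjacency_tensor k E js = (if set js \<in> E then 1 / fact (k - 1) else 0)"

definition degree_tensor :: "nat set set \<Rightarrow> tensor" where
  "degree_tensor E js = (if \<forall>j\<in>set js. j = hd js then real (degree E (hd js)) else 0)"

definition signless_laplacian_tensor :: "nat \<Rightarrow> nat set set \<Rightarrow> tensor" where
  "signless_laplacian_tensor k E js = degree_tensor E js + adjacency_tensor k E js"

definition incidence_Q_tensor :: "nat set set \<Rightarrow> tensor" where
  "incidence_Q_tensor E js = real (card {e \<in> E. \<forall>j\<in>set js. j \<in> e})"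

end

theory Submission
  imports Defs "HOL-Analysis.Analysis" "HOL-Combinatorics.Multiset_Permutations"
begin

text \<open>
  The spectral radius of a symmetric nonnegative tensor \<open>T\<close> of order \<open>k\<close> is the maximum of its form
  \<open>\<Sum> T\<^bsub>i\<^sub>1\<dots>i\<^sub>k\<^esub> x\<^bsub>i\<^sub>1\<^esub> \<cdots> x\<^bsub>i\<^sub>k\<^esub>\<close> over the nonnegative vectors with \<open>\<Sum> x\<^sub>i\<^sup>k = 1\<close>
  (\<open>spectral_radius_symmetric_nonneg\<close>).  For the three tensors of a hypergraph the form is a sum
  over the edges \<open>e\<close> of, respectively,
  \<open>k \<Prod>\<^bsub>v\<in>e\<^esub> x\<^sub>v\<close>, \<open>\<Sum>\<^bsub>v\<in>e\<^esub> x\<^sub>v\<^sup>k + k \<Prod>\<^bsub>v\<in>e\<^esub> x\<^sub>v\<close> and \<open>(\<Sum>\<^bsub>v\<in>e\<^esub> x\<^sub>v)\<^sup>k\<close>.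

  All three bounds come from one choice of weights.  Let \<open>B(v,e)\<close> be the fraction of the \<open>m\<close> edges
  that are reached from the vertex \<open>v\<close> through its incident edge \<open>e\<close> (the edge \<open>e\<close> included).
  At each vertex these fractions add up to \<open>1\<close>.  For each edge \<open>e\<close>, every other edge \<open>f\<close> lies
  behind exactly one vertex of \<open>e\<close>, so that \<open>\<Sum>\<^bsub>v\<in>e\<^esub> (1 - B(v,e)) = 1 - 1/m\<close>
  (\<open>supertree_weights\<close>).
  It therefore suffices to bound the contribution of each single edge by
  \<open>\<mu> \<Sum>\<^bsub>v\<in>e\<^esub> B(v,e) x\<^sub>v\<^sup>k\<close>, where \<open>\<mu>\<close> is the claimed bound on the spectral radius; summing over the
  edges gives \<open>\<mu> \<Sum>\<^sub>v x\<^sub>v\<^sup>k\<close>.  For the first two tensors the bound for one edge is the inequality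
  between arithmetic and geometric means with coefficients \<open>C\<^sub>v\<close> of product at least \<open>1\<close>: these are
  \<open>C\<^sub>v = \<mu> B(v,e)\<close> and \<open>C\<^sub>v = (1 + \<alpha>) B(v,e) - 1\<close>, and the Weierstrass inequality
  \<open>\<Prod>(1 - t\<^sub>v) \<ge> 1 - \<Sum> t\<^sub>v\<close> bounds their product.  For the third it is Jensen's inequality for
  \<open>t\<^sup>k\<close>, in which the Weierstrass inequality again controls the constant.

  If no vertex lies on all edges, then some edge contains two vertices of degree at least \<open>2\<close>
  (\<open>not_star_edge\<close>).  There two of the numbers \<open>1 - B(v,e)\<close> are positive and the Weierstrass
  inequality is strict, so the bound is not attained by a positive vector.  A maximiser of the form
  that has zeros is handled separately: by connectedness some edge contains both a zero and a nonzero
  entry, and the bound is strict on that edge.  If some vertex lies on all edges, i.e. in a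
  hyperstar, a vector that is constant on the other vertices attains the bound.
\<close>

section \<open>Spectral radii of symmetric nonnegative tensors\<close>

lemma sum_lists_Suc:
  fixes h :: "nat list \<Rightarrow> 'a::comm_monoid_add"
  shows "(\<Sum>js \<in> {js. length js = Suc p \<and> set js \<subseteq> A}. h js)
       = (\<Sum>i\<in>A. \<Sum>js \<in> {js. length js = p \<and> set js \<subseteq> A}. h (i # js))"
proof -
  have eq: "{js. length js = Suc p \<and> set js \<subseteq> A}
      = (\<lambda>(i, js). i # js) ` (A \<times> {js. length js = p \<and> set js \<subseteq> A})"
    by (auto simp: length_Suc_conv image_iff)
  show ?thesis
    unfolding eq
    by (subst sum.reindex) (auto simp: inj_on_def sum.cartesian_product case_prod_beta)
qed

lemma sum_lists_prod_list:
  fixes x :: "nat \<Rightarrow> 'a::comm_semiring_1"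
  shows "(\<Sum>js \<in> {js. length js = p \<and> set js \<subseteq> A}. \<Prod>j\<leftarrow>js. x j) = (\<Sum>i\<in>A. x i) ^ p"
proof (induction p)
  case 0
  have "{js. length js = 0 \<and> set js \<subseteq> A} = {[]}" by auto
  then show ?case by simp
next
  case (Suc p)
  show ?case
    by (simp only: sum_lists_Suc list.map prod_list.Cons sum_distrib_left [symmetric]
        Suc.IH sum_distrib_right [symmetric] power_Suc)
qed

text \<open>
  The homogeneous form of degree \<open>p\<close> that a real tensor of order \<open>p\<close> defines on \<open>\<real>\<^sup>n\<close>.  The order is
  a parameter because the coordinates of \<open>T x\<close> are themselves forms of order one less, those of
  the tensors \<open>\<lambda>js. T (i # js)\<close>; this makes induction on the order possible.
\<close>
definition tensor_form :: "nat \<Rightarrow> nat \<Rightarrow> tensor \<Rightarrow> (nat \<Rightarrow> real) \<Rightarrow> real" where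
  "tensor_form p n T x =
     (\<Sum>js \<in> {js. length js = p \<and> set js \<subseteq> {1..n}}. T js * (\<Prod>j\<leftarrow>js. x j))"

text \<open>Entries are invariant under permutations of the index list.\<close>
definition symmetric_tensor :: "tensor \<Rightarrow> bool" where
  "symmetric_tensor T \<longleftrightarrow> (\<forall>js js'. mset js = mset js' \<longrightarrow> T js = T js')"

lemma symmetric_tensor_Cons:
  "symmetric_tensor T \<Longrightarrow> symmetric_tensor (\<lambda>js. T (i # js))"
  unfolding symmetric_tensor_def by (metis mset.simps(2))

lemma tensor_form_0: "tensor_form 0 n T x = T []"
proof -
  have "{js. length js = 0 \<and> set js \<subseteq> {1..n}} = {[]}" by auto
  then show ?thesis by (simp add: tensor_form_def)
qed

lemma tensor_form_Suc:
  "tensor_form (Suc p) n T x = (\<Sum>i\<in>{1..n}. x i * tensor_form p n (\<lambda>js. T (i # js)) x)"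
  unfolding tensor_form_def
  by (simp only: sum_lists_Suc sum_distrib_left) (simp add: mult_ac)

lemma tensor_form_cong:
  "(\<And>i. i \<in> {1..n} \<Longrightarrow> x i = y i) \<Longrightarrow> tensor_form p n T x = tensor_form p n T y"
  by (induction p arbitrary: T) (simp_all add: tensor_form_0 tensor_form_Suc)

lemma tensor_form_scale:
  "tensor_form p n T (\<lambda>i. c * x i) = c ^ p * tensor_form p n T x"
  by (induction p arbitrary: T)
    (simp_all add: tensor_form_0 tensor_form_Suc sum_distrib_left mult_ac)

lemma tensor_form_nonneg:
  assumes "\<And>js. 0 \<le> T js" and "\<And>i. i \<in> {1..n} \<Longrightarrow> 0 \<le> x i"
  shows "0 \<le> tensor_form p n T x"
  using assms(1)
  by (induction p arbitrary: T)
    (auto simp: tensor_form_0 tensor_form_Suc intro!: sum_nonneg mult_nonneg_nonneg assms(2))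

lemma continuous_on_tensor_form: "continuous_on UNIV (tensor_form p n T)"
proof (induction p arbitrary: T)
  case 0
  then show ?case by (simp add: tensor_form_0 [abs_def])
next
  case (Suc p)
  show ?case
    unfolding tensor_form_Suc [abs_def]
    by (intro continuous_on_sum continuous_on_mult Suc.IH continuous_on_product_coordinates)
qed

text \<open>
  By symmetry, the \<open>i\<close>-th partial derivative of the form of a tensor of order \<open>p + 1\<close> is \<open>p + 1\<close>
  times the \<open>i\<close>-th coordinate of the tensor applied to the vector.  The vector is varied in the one
  coordinate \<open>i\<close>.
\<close>
lemma tensor_form_has_partial_derivative:
  assumes "symmetric_tensor T" and i: "i \<in> {1..n}"
  shows "((\<lambda>t. tensor_form (Suc p) n T (x(i := t))) has_real_derivative
           real (Suc p) * tensor_form p n (\<lambda>js. T (i # js)) (x(i := t))) (at t)"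
  using assms(1)
proof (induction p arbitrary: T)
  case 0
  have "tensor_form (Suc 0) n T (x(i := s)) = s * T [i] + (\<Sum>j\<in>{1..n} - {i}. x j * T [j])" for s
    unfolding tensor_form_Suc tensor_form_0 by (subst sum.remove [OF _ i]) simp_all
  then have eq: "(\<lambda>s. tensor_form (Suc 0) n T (x(i := s)))
      = (\<lambda>s. s * T [i] + (\<Sum>j\<in>{1..n} - {i}. x j * T [j]))"
    by (rule ext)
  show ?case
    unfolding eq by (auto simp: tensor_form_0 intro!: derivative_eq_intros)
next
  case (Suc p)
  have swap: "(\<lambda>js. T (j # i # js)) = (\<lambda>js. T (i # j # js))" for j
    using Suc.prems unfolding symmetric_tensor_def
    by (intro ext) (metis add_mset_commute mset.simps(2))
  let ?F = "\<lambda>j. tensor_form (Suc p) n (\<lambda>js. T (j # js))"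
  let ?G = "\<lambda>j. tensor_form p n (\<lambda>js. T (i # j # js))"
  have "((\<lambda>s. \<Sum>j\<in>{1..n}. (x(i := s)) j * ?F j (x(i := s))) has_real_derivative
          (\<Sum>j\<in>{1..n}. (if j = i then 1 else 0) * ?F j (x(i := t))
             + real (Suc p) * ?G j (x(i := t)) * (x(i := t)) j)) (at t)"
  proof (intro DERIV_sum DERIV_mult)
    fix j
    show "((\<lambda>s. (x(i := s)) j) has_real_derivative (if j = i then 1 else 0)) (at t)"
      by (cases "j = i") auto
    show "((\<lambda>s. ?F j (x(i := s))) has_real_derivative real (Suc p) * ?G j (x(i := t))) (at t)"
      using Suc.IH [OF symmetric_tensor_Cons [OF Suc.prems, of j]] by (simp only: swap)
  qed
  also have "(\<Sum>j\<in>{1..n}. (if j = i then 1 else 0) * ?F j (x(i := t))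
             + real (Suc p) * ?G j (x(i := t)) * (x(i := t)) j)
      = ?F i (x(i := t)) + real (Suc p) * (\<Sum>j\<in>{1..n}. (x(i := t)) j * ?G j (x(i := t)))"
  proof -
    have "(\<Sum>j\<in>{1..n}. (if j = i then 1 else 0) * ?F j (x(i := t))) = ?F i (x(i := t))"
      using i by (simp add: if_distrib [of "\<lambda>u. u * _"] cong: if_cong)
    then show ?thesis
      by (simp only: sum.distrib sum_distrib_left mult_ac)
  qed
  also have "\<dots> = real (Suc (Suc p)) * ?F i (x(i := t))"
    by (subst (2) tensor_form_Suc) (simp add: tensor_form_Suc algebra_simps)
  finally show ?case
    by (subst tensor_form_Suc)
qed

lemma tensor_apply_of_real:
  "tensor_apply k n T (\<lambda>i. of_real (x i)) i
     = of_real (tensor_form (k - 1) n (\<lambda>js. T (i # js)) x)"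
proof -
  have "(\<Prod>j\<leftarrow>js. of_real (x j)) = complex_of_real (\<Prod>j\<leftarrow>js. x j)" for js
    by (induction js) auto
  then show ?thesis
    by (simp add: tensor_apply_def tensor_form_def)
qed

lemma norm_tensor_apply_le:
  assumes "\<And>js. 0 \<le> T js"
  shows "cmod (tensor_apply k n T z i)
     \<le> tensor_form (k - 1) n (\<lambda>js. T (i # js)) (\<lambda>j. cmod (z j))"
proof -
  have "cmod (\<Prod>j\<leftarrow>js. z j) = (\<Prod>j\<leftarrow>js. cmod (z j))" for js
    by (induction js) (auto simp: norm_mult)
  then show ?thesis
    unfolding tensor_apply_def tensor_form_def
    by (intro sum_norm_le) (simp add: norm_mult assms)
qed

text \<open>
  The maximum over the sphere exists by compactness; homogeneity extends the resulting inequality to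
  all nonnegative vectors.  Vectors are functions on all of \<open>nat\<close>, so the compact set consists of the
  functions with values in \<open>[0,1]\<close> that vanish outside \<open>{1..n}\<close>, in the product topology.
\<close>
lemma tensor_form_max_on_sphere:
  assumes "k \<ge> 2" and "n \<ge> 1"
  obtains x where "\<And>i. 0 \<le> x i" and "(\<Sum>i\<in>{1..n}. x i ^ k) = 1"
    and "\<And>y. (\<And>i. i \<in> {1..n} \<Longrightarrow> 0 \<le> y i) \<Longrightarrow>
           tensor_form k n T y \<le> tensor_form k n T x * (\<Sum>i\<in>{1..n}. y i ^ k)"
proof -
  define K :: "(nat \<Rightarrow> real) set" where
    "K = PiE UNIV (\<lambda>i. if i \<in> {1..n} then {0..1} else {0})"
  define S where "S = K \<inter> {x. (\<Sum>i\<in>{1..n}. x i ^ k) = 1}"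
  have "compactin (product_topology (\<lambda>_. euclidean) UNIV) K"
    unfolding K_def compactin_PiE by auto
  then have "compact K"
    by (simp add: euclidean_product_topology)
  moreover have "closed {x :: nat \<Rightarrow> real. (\<Sum>i\<in>{1..n}. x i ^ k) = 1}"
    by (intro closed_Collect_eq continuous_on_sum continuous_on_power
        continuous_on_product_coordinates continuous_on_const)
  ultimately have "compact S"
    unfolding S_def by (rule compact_Int_closed)
  moreover have "S \<noteq> {}"
  proof -
    have "(\<lambda>i. if i = 1 then 1 else 0) \<in> K"
      using \<open>n \<ge> 1\<close> by (auto simp: K_def PiE_iff)
    moreover have "(\<Sum>i\<in>{1..n}. (if i = 1 then 1 else 0 :: real) ^ k) = 1"
      using assms by (simp add: if_distrib [of "\<lambda>u. u ^ k"] power_0_left cong: if_cong)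
    ultimately show ?thesis by (auto simp: S_def)
  qed
  ultimately obtain x where x: "x \<in> S" and max: "\<And>y. y \<in> S \<Longrightarrow> tensor_form k n T y \<le> tensor_form k n T x"
    using continuous_attains_sup [of S "tensor_form k n T"]
      continuous_on_subset [OF continuous_on_tensor_form subset_UNIV]
    by (metis (no_types, lifting))
  show ?thesis
  proof
    show "0 \<le> x i" for i
    proof -
      have "x i \<in> (if i \<in> {1..n} then {0..1} else {0})"
        using x by (auto simp: S_def K_def PiE_iff)
      then show ?thesis by (auto split: if_splits)
    qed
    show "(\<Sum>i\<in>{1..n}. x i ^ k) = 1"
      using x by (simp add: S_def)
  next
    fix y :: "nat \<Rightarrow> real"
    assume y: "\<And>i. i \<in> {1..n} \<Longrightarrow> 0 \<le> y i"
    define N where "N = (\<Sum>i\<in>{1..n}. y i ^ k)"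
    have "0 \<le> N" unfolding N_def by (intro sum_nonneg) (simp add: y)
    show "tensor_form k n T y \<le> tensor_form k n T x * (\<Sum>i\<in>{1..n}. y i ^ k)"
    proof (cases "N = 0")
      case True
      then have "y i = 0 * y i" if "i \<in> {1..n}" for i
        using that y \<open>k \<ge> 2\<close> unfolding N_def
        by (subst (asm) sum_nonneg_eq_0_iff) auto
      then have "tensor_form k n T y = tensor_form k n T (\<lambda>i. 0 * y i)"
        by (rule tensor_form_cong)
      also have "\<dots> = 0"
        using \<open>k \<ge> 2\<close> by (subst tensor_form_scale) simp
      finally show ?thesis using True by (simp add: N_def)
    next
      case False
      with \<open>0 \<le> N\<close> have "0 < N" by simp
      define s where "s = root k N"
      have s: "0 < s" "s ^ k = N"
        using \<open>0 < N\<close> \<open>k \<ge> 2\<close> by (auto simp: s_def)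
      define z where "z = (\<lambda>i. if i \<in> {1..n} then inverse s * y i else 0)"
      have z1: "(\<Sum>i\<in>{1..n}. z i ^ k) = 1"
      proof -
        have "(\<Sum>i\<in>{1..n}. z i ^ k) = inverse s ^ k * N"
          by (simp add: z_def N_def sum_distrib_left power_mult_distrib)
        then show ?thesis using s \<open>0 < N\<close> by (simp add: power_inverse)
      qed
      have z0: "0 \<le> z i" for i using y s by (simp add: z_def)
      have "z i \<le> 1" if "i \<in> {1..n}" for i
      proof -
        have "z i ^ k \<le> (\<Sum>i\<in>{1..n}. z i ^ k)"
          using that z0 by (intro member_le_sum) auto
        then have "z i ^ k \<le> 1 ^ k" unfolding z1 by simp
        then show ?thesis using z0 \<open>k \<ge> 2\<close> by (subst (asm) power_mono_iff) auto
      qed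
      with z0 have "z \<in> K" by (auto simp: K_def PiE_iff) (auto simp: z_def)
      with z1 have "z \<in> S" by (simp add: S_def)
      then have "tensor_form k n T z \<le> tensor_form k n T x" by (rule max)
      moreover have "tensor_form k n T y = s ^ k * tensor_form k n T z"
        unfolding tensor_form_scale [symmetric]
        using s by (intro tensor_form_cong) (simp add: z_def)
      ultimately show ?thesis
        unfolding N_def [symmetric] using s \<open>0 < N\<close> by (simp add: mult.commute)
    qed
  qed
qed

text \<open>
  A maximiser of the form satisfies the first-order conditions, hence is an eigenvector whose
  eigenvalue is the maximum.  Any other eigenvalue is bounded by passing to the moduli of the
  entries of an eigenvector.
\<close>
theorem spectral_radius_symmetric_nonneg:
  assumes k: "k \<ge> 2" and n: "n \<ge> 1"
    and sym: "symmetric_tensor T" and nonneg: "\<And>js. 0 \<le> T js"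
  obtains x where "\<And>i. 0 \<le> x i" and "(\<Sum>i\<in>{1..n}. x i ^ k) = 1"
    and "tensor_form k n T x = spectral_radius k n T"
    and "\<And>y. (\<And>i. i \<in> {1..n} \<Longrightarrow> 0 \<le> y i) \<Longrightarrow>
           tensor_form k n T y \<le> spectral_radius k n T * (\<Sum>i\<in>{1..n}. y i ^ k)"
proof -
  obtain x where x0: "\<And>i. 0 \<le> x i" and x1: "(\<Sum>i\<in>{1..n}. x i ^ k) = 1"
    and max: "\<And>y. (\<And>i. i \<in> {1..n} \<Longrightarrow> 0 \<le> y i) \<Longrightarrow>
           tensor_form k n T y \<le> tensor_form k n T x * (\<Sum>i\<in>{1..n}. y i ^ k)"
    using tensor_form_max_on_sphere [OF k n, where T = T] by blast
  define l where "l = tensor_form k n T x"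
  have l0: "0 \<le> l"
    unfolding l_def by (intro tensor_form_nonneg nonneg x0)
  define g where "g = (\<lambda>i. tensor_form (k - 1) n (\<lambda>js. T (i # js)))"
  have Suck: "Suc (k - 1) = k" using k by simp
  \<comment> \<open>At a zero coordinate only the one-sided condition \<open>g i x \<le> 0\<close> is available, but \<open>g i x\<close> is
    nonnegative anyway.\<close>
  have kkt: "g i x = l * x i ^ (k - 1)" if i: "i \<in> {1..n}" for i
  proof -
    define h where "h = (\<lambda>t. l * (\<Sum>j\<in>{1..n}. (x(i := t)) j ^ k) - tensor_form k n T (x(i := t)))"
    have split: "(\<Sum>j\<in>{1..n}. (x(i := t)) j ^ k) = t ^ k + (\<Sum>j\<in>{1..n} - {i}. x j ^ k)" for t
      by (subst sum.remove [OF _ i]) simp_all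
    have D: "(h has_real_derivative real k * (l * x i ^ (k - 1) - g i x)) (at (x i))"
      using tensor_form_has_partial_derivative [OF sym i, of "k - 1" x "x i"]
      unfolding h_def split Suck g_def
      by (auto intro!: derivative_eq_intros simp: algebra_simps)
    have h_nonneg: "0 \<le> h t" if "0 \<le> t" for t
      using max [of "x(i := t)"] x0 that by (simp add: h_def l_def)
    have h_zero: "h (x i) = 0"
      by (simp only: h_def fun_upd_triv x1 l_def mult_1_right diff_self)
    show ?thesis
    proof (cases "x i = 0")
      case False
      with x0 [of i] have pos: "0 < x i" by simp
      have "\<forall>t. \<bar>x i - t\<bar> < x i \<longrightarrow> h (x i) \<le> h t"
        using h_zero h_nonneg by auto
      then have "real k * (l * x i ^ (k - 1) - g i x) = 0"
        using DERIV_local_min [OF D pos] by blast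
      with k show ?thesis by simp
    next
      case True
      have "\<not> real k * (l * x i ^ (k - 1) - g i x) < 0"
      proof
        assume "real k * (l * x i ^ (k - 1) - g i x) < 0"
        from DERIV_neg_dec_right [OF D this] obtain d where "0 < d"
          and d: "\<And>t. 0 < t \<Longrightarrow> t < d \<Longrightarrow> h (x i + t) < h (x i)" by blast
        from d [of "d / 2"] h_nonneg [of "x i + d / 2"] \<open>0 < d\<close> show False
          by (simp add: True h_zero [unfolded True])
      qed
      moreover have "0 \<le> g i x"
        unfolding g_def by (intro tensor_form_nonneg nonneg x0)
      ultimately show ?thesis
        using k by (auto simp: True not_less mult_le_0_iff power_0_left)
    qed
  qed
  have "spectral_radius k n T = l"
    unfolding spectral_radius_def
  proof (rule Greatest_equality)
    have "\<exists>i\<in>{1..n}. x i \<noteq> 0"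
    proof (rule ccontr)
      assume "\<not> ?thesis"
      then have "(\<Sum>i\<in>{1..n}. x i ^ k) = 0" using k by (simp add: power_0_left)
      with x1 show False by simp
    qed
    moreover have "tensor_apply k n T (\<lambda>i. of_real (x i)) i = of_real l * of_real (x i) ^ (k - 1)"
      if "i \<in> {1..n}" for i
      using kkt [OF that] by (simp only: tensor_apply_of_real g_def of_real_mult of_real_power)
    ultimately have "tensor_eigenvalue k n T (of_real l)"
      unfolding tensor_eigenvalue_def
      by (intro exI [of _ "\<lambda>i. of_real (x i)"]) (simp del: One_nat_def)
    then show "\<exists>c. tensor_eigenvalue k n T c \<and> l = cmod c"
      using l0 by (intro exI [of _ "of_real l"]) simp
  next
    fix r
    assume "\<exists>c. tensor_eigenvalue k n T c \<and> r = cmod c"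
    then obtain c z i0 where r: "r = cmod c" and i0: "i0 \<in> {1..n}" "z i0 \<noteq> 0"
      and z: "\<And>i. i \<in> {1..n} \<Longrightarrow> tensor_apply k n T z i = c * z i ^ (k - 1)"
      unfolding tensor_eigenvalue_def by blast
    define w where "w = (\<lambda>i. cmod (z i))"
    define N where "N = (\<Sum>i\<in>{1..n}. w i ^ k)"
    have "0 < w i0 ^ k" using i0 by (simp add: w_def)
    also have "\<dots> \<le> N"
      unfolding N_def using i0(1) by (intro member_le_sum) (auto simp: w_def)
    finally have "0 < N" .
    have "r * N = (\<Sum>i\<in>{1..n}. w i * cmod (c * z i ^ (k - 1)))"
      unfolding N_def sum_distrib_left
      by (intro sum.cong refl, subst Suck [symmetric], subst power_Suc)
        (simp add: r w_def norm_mult norm_power)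
    also have "\<dots> \<le> (\<Sum>i\<in>{1..n}. w i * g i w)"
    proof (intro sum_mono mult_left_mono)
      show "cmod (c * z i ^ (k - 1)) \<le> g i w" if "i \<in> {1..n}" for i
        using norm_tensor_apply_le [where T = T and k = k and n = n and z = z and i = i, OF nonneg]
        unfolding z [OF that] g_def w_def .
    qed (simp add: w_def)
    also have "\<dots> = tensor_form k n T w"
      unfolding g_def using tensor_form_Suc [of "k - 1" n T w] by (simp only: Suck)
    also have "\<dots> \<le> l * N"
      unfolding l_def N_def by (rule max) (simp add: w_def)
    finally show "r \<le> l" using \<open>0 < N\<close> by simp
  qed
  with that [OF x0 x1] max show thesis by (simp add: l_def)
qed

section \<open>Supertrees rooted at an edge\<close>

lemma hyperpath_trivial: "v \<in> {1..n} \<Longrightarrow> hyperpath n E 0 [v] []"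
  by (simp add: hyperpath_def)

lemma hyperpath_edge:
  "\<lbrakk>e \<in> E; e \<subseteq> {1..n}; u \<in> e; v \<in> e; u \<noteq> v\<rbrakk> \<Longrightarrow> hyperpath n E 1 [u, v] [e]"
  by (auto simp: hyperpath_def)

lemma hyperpath_mono: "hyperpath n E q vs es \<Longrightarrow> E \<subseteq> E' \<Longrightarrow> hyperpath n E' q vs es"
  by (auto simp: hyperpath_def)

lemma hyperpath_rev:
  assumes "hyperpath n E q vs es"
  shows "hyperpath n E q (rev vs) (rev es)"
proof -
  have "rev vs ! r \<in> rev es ! r \<and> rev vs ! (r + 1) \<in> rev es ! r" if "r < q" for r
  proof -
    have "rev vs ! r = vs ! (q - 1 - r + 1)" "rev vs ! (r + 1) = vs ! (q - 1 - r)"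
      "rev es ! r = es ! (q - 1 - r)" "q - 1 - r < q"
      using assms that by (auto simp: hyperpath_def rev_nth Suc_diff_Suc)
    with assms show ?thesis by (simp add: hyperpath_def)
  qed
  with assms show ?thesis by (simp add: hyperpath_def)
qed

lemma hyperpath_Cons:
  assumes path: "hyperpath n E q vs es" and e: "e \<notin> E" "u \<in> e" "vs ! 0 \<in> e"
    and u: "u \<notin> set vs" "u \<in> {1..n}"
  shows "hyperpath n (insert e E) (q + 1) (u # vs) (e # es)"
proof -
  have "(u # vs) ! r \<in> (e # es) ! r \<and> (u # vs) ! (r + 1) \<in> (e # es) ! r" if "r < q + 1" for r
    using path e that by (cases r) (auto simp: hyperpath_def)
  moreover have "e \<notin> set es" using path e(1) by (auto simp: hyperpath_def)
  ultimately show ?thesis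
    using path u by (auto simp: hyperpath_def)
qed

lemma hyperpath_closed:
  assumes path: "hyperpath n E q vs es" and "vs ! 0 \<in> U"
    and closed: "\<And>e. e \<in> E \<Longrightarrow> e \<inter> U \<noteq> {} \<Longrightarrow> e \<subseteq> U"
  shows "r \<le> q \<Longrightarrow> vs ! r \<in> U"
proof (induction r)
  case (Suc r)
  then have "vs ! r \<in> es ! r" "vs ! (r + 1) \<in> es ! r" "es ! r \<in> E" "vs ! r \<in> U"
    using path by (auto simp: hyperpath_def)
  with closed [of "es ! r"] show ?case by auto
qed (use assms(2) in simp)

lemma hyper_connected_closed:
  assumes "hyper_connected n E" and "u \<in> {1..n}" "u \<in> U"
    and "\<And>e. e \<in> E \<Longrightarrow> e \<inter> U \<noteq> {} \<Longrightarrow> e \<subseteq> U"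
  shows "{1..n} \<subseteq> U"
proof
  fix v assume "v \<in> {1..n}"
  with assms(1,2) obtain q vs es where "hyperpath n E q vs es" "vs ! 0 = u" "vs ! q = v"
    unfolding hyper_connected_def by blast
  with hyperpath_closed [of n E q vs es U q] assms(3,4) show "v \<in> U" by blast
qed

text \<open>
  Closing a path by an edge outside it would give a cycle, unless the path is trivial.
\<close>
lemma hyper_acyclic_no_chord:
  assumes acyclic: "hyper_acyclic n E" and path: "hyperpath n S q vs es" and "S \<subseteq> E"
    and e: "e \<in> E" "e \<notin> S" "vs ! 0 \<in> e" "vs ! q \<in> e"
  shows "vs ! 0 = vs ! q"
proof (rule ccontr)
  assume neq: "vs ! 0 \<noteq> vs ! q"
  then have "0 < q" by (cases q) auto
  have "(vs @ [vs ! 0]) ! r \<in> (es @ [e]) ! r \<and> (vs @ [vs ! 0]) ! (r + 1) \<in> (es @ [e]) ! r"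
    if "r < q + 1" for r
  proof (cases "r = q")
    case True
    then show ?thesis using path e by (auto simp: hyperpath_def nth_append)
  next
    case False
    with that have "r < q" by simp
    then show ?thesis using path by (auto simp: hyperpath_def nth_append)
  qed
  moreover have "e \<notin> set es" using path e(2) by (auto simp: hyperpath_def)
  moreover have "vs ! 0 \<in> set vs" using path by (auto simp: hyperpath_def)
  moreover from this have "vs ! 0 \<in> {1..n}" using path unfolding hyperpath_def by blast
  ultimately have "hypercycle n E (q + 1) (vs @ [vs ! 0]) (es @ [e])"
    using path \<open>S \<subseteq> E\<close> e(1) \<open>0 < q\<close>
    by (auto simp: hypercycle_def hyperpath_def nth_append)
  with acyclic show False by (auto simp: hyper_acyclic_def)
qed

lemma supertreeD:
  assumes "supertree n k E"
  shows "hyper_connected n E" "hyper_acyclic n E"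
    and "\<And>e. e \<in> E \<Longrightarrow> e \<subseteq> {1..n}" "\<And>e. e \<in> E \<Longrightarrow> card e = k" "\<And>e. e \<in> E \<Longrightarrow> finite e"
    and "finite E" "\<And>e v. e \<in> E \<Longrightarrow> v \<in> e \<Longrightarrow> v \<in> {1..n}"
proof -
  show "hyper_connected n E" "hyper_acyclic n E"
    and sub: "\<And>e. e \<in> E \<Longrightarrow> e \<subseteq> {1..n}" and "\<And>e. e \<in> E \<Longrightarrow> card e = k"
    using assms by (auto simp: supertree_def uniform_hypergraph_def)
  show "\<And>e. e \<in> E \<Longrightarrow> finite e" using sub finite_subset by blast
  show "\<And>e v. e \<in> E \<Longrightarrow> v \<in> e \<Longrightarrow> v \<in> {1..n}" using sub by blast
  show "finite E" using sub by (meson Pow_iff finite_Pow_iff finite_atLeastAtMost finite_subset subsetI)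
qed

text \<open>
  The vertices \<open>u\<close> and \<open>v\<close> are connected by a path within the set \<open>S\<close> of edges.  The path must
  stay in \<open>\<Union>S\<close>, which matters only for a path of length \<open>0\<close>: its single vertex has to lie on an
  edge of \<open>S\<close>.
\<close>
definition joined :: "nat \<Rightarrow> nat set set \<Rightarrow> nat \<Rightarrow> nat \<Rightarrow> bool" where
  "joined n S u v \<longleftrightarrow>
     (\<exists>q vs es. hyperpath n S q vs es \<and> set vs \<subseteq> \<Union>S \<and> vs ! 0 = u \<and> vs ! q = v)"

lemma joinedI:
  "\<lbrakk>hyperpath n S q vs es; set vs \<subseteq> \<Union>S; vs ! 0 = u; vs ! q = v\<rbrakk> \<Longrightarrow> joined n S u v"
  unfolding joined_def by blast

lemma joinedE:
  assumes "joined n S u v"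
  obtains q vs es where "hyperpath n S q vs es" "set vs \<subseteq> \<Union>S" "vs ! 0 = u" "vs ! q = v"
  using assms unfolding joined_def by blast

lemma joined_sym:
  assumes "joined n S u v"
  shows "joined n S v u"
proof -
  from assms obtain q vs es where path: "hyperpath n S q vs es"
    "set vs \<subseteq> \<Union>S" "vs ! 0 = u" "vs ! q = v" by (rule joinedE)
  then have "length vs = q + 1" by (simp add: hyperpath_def)
  then have "rev vs ! 0 = v" "rev vs ! q = u" using path by (simp_all add: rev_nth)
  with path(2) show ?thesis
    by (intro joinedI [OF hyperpath_rev [OF path(1)]]) simp_all
qed

lemma joined_mono:
  assumes "joined n S u v" "S \<subseteq> S'"
  shows "joined n S' u v"
proof -
  from assms(1) obtain q vs es where path: "hyperpath n S q vs es"
    "set vs \<subseteq> \<Union>S" "vs ! 0 = u" "vs ! q = v" by (rule joinedE)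
  have "set vs \<subseteq> \<Union>S'" using path(2) assms(2) by blast
  with path(3,4) show ?thesis
    by (intro joinedI [OF hyperpath_mono [OF path(1) assms(2)]])
qed

lemma joined_edge:
  assumes "f \<subseteq> {1..n}" "f \<in> S" "u \<in> f" "v \<in> f"
  shows "joined n S u v"
proof (cases "u = v")
  case True
  have "v \<in> {1..n}" using assms by blast
  with assms True show ?thesis
    by (intro joinedI [OF hyperpath_trivial [of v n]]) auto
next
  case False
  with assms show ?thesis
    by (intro joinedI [OF hyperpath_edge [of f S n u v]]) auto
qed

text \<open>
  A connected set \<open>S\<close> of edges, rooted at the edge \<open>f \<in> S\<close>: \<open>p v\<close> is the edge at the vertex \<open>v\<close> in
  the direction of \<open>f\<close>, and every edge other than \<open>f\<close> has exactly one vertex whose edge towards the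
  root is a different one.
\<close>
definition rooted_subtree :: "nat \<Rightarrow> nat set \<Rightarrow> nat set set \<Rightarrow> (nat \<Rightarrow> nat set) \<Rightarrow> bool" where
  "rooted_subtree n f S p \<longleftrightarrow>
     f \<in> S \<and> (\<forall>v\<in>f. p v = f) \<and> (\<forall>v\<in>\<Union>S. p v \<in> S \<and> v \<in> p v)
     \<and> (\<forall>e\<in>S. e \<noteq> f \<longrightarrow> (\<exists>w. {v\<in>e. p v \<noteq> e} = {w}))
     \<and> (\<forall>u\<in>\<Union>S. \<forall>v\<in>\<Union>S. joined n S u v)"

lemma rooted_subtreeD:
  assumes "rooted_subtree n f S p"
  shows "f \<in> S" and "\<And>v. v \<in> f \<Longrightarrow> p v = f"
    and "\<And>v e. e \<in> S \<Longrightarrow> v \<in> e \<Longrightarrow> p v \<in> S" "\<And>v e. e \<in> S \<Longrightarrow> v \<in> e \<Longrightarrow> v \<in> p v"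
    and "\<And>e. e \<in> S \<Longrightarrow> e \<noteq> f \<Longrightarrow> \<exists>w. {v\<in>e. p v \<noteq> e} = {w}"
    and "\<And>u v. u \<in> \<Union>S \<Longrightarrow> v \<in> \<Union>S \<Longrightarrow> joined n S u v"
proof -
  show "f \<in> S" "\<And>v. v \<in> f \<Longrightarrow> p v = f"
    and "\<And>v e. e \<in> S \<Longrightarrow> v \<in> e \<Longrightarrow> p v \<in> S" "\<And>v e. e \<in> S \<Longrightarrow> v \<in> e \<Longrightarrow> v \<in> p v"
    and "\<And>e. e \<in> S \<Longrightarrow> e \<noteq> f \<Longrightarrow> \<exists>w. {v\<in>e. p v \<noteq> e} = {w}"
    using assms by (auto simp: rooted_subtree_def)
  show "joined n S u v" if "u \<in> \<Union>S" "v \<in> \<Union>S" for u v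
    using assms that unfolding rooted_subtree_def by blast
qed

lemma rooted_subtree_singleton:
  assumes "f \<subseteq> {1..n}"
  shows "rooted_subtree n f {f} (\<lambda>_. f)"
  using joined_edge [OF assms, of "{f}"] by (simp add: rooted_subtree_def)

text \<open>
  An edge that meets the vertices of \<open>S\<close> meets them in a single vertex \<open>w\<close>, as two such vertices
  would be joined within \<open>S\<close> and so close a cycle.  All other vertices of the new edge are new.
\<close>
lemma rooted_subtree_extend:
  assumes tree: "rooted_subtree n f S p" and acyclic: "hyper_acyclic n E" and "S \<subseteq> E"
    and e: "e \<in> E" "e \<notin> S" "e \<subseteq> {1..n}" "e \<inter> \<Union>S \<noteq> {}"
  shows "rooted_subtree n f (insert e S) (\<lambda>v. if v \<in> \<Union>S then p v else e)"
proof -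
  let ?p = "\<lambda>v. if v \<in> \<Union>S then p v else e"
  from e obtain w where w: "w \<in> e" "w \<in> \<Union>S" by blast
  have unique: "u = w" if "u \<in> e" "u \<in> \<Union>S" for u
    using rooted_subtreeD(6) [OF tree that(2) w(2)] w(1) that(1)
      hyper_acyclic_no_chord [OF acyclic _ \<open>S \<subseteq> E\<close> e(1,2)]
    by (metis joinedE)
  have parent: "\<exists>w. {v\<in>e'. ?p v \<noteq> e'} = {w}" if "e' \<in> insert e S" "e' \<noteq> f" for e'
  proof (cases "e' = e")
    case True
    have "p w \<in> S" using rooted_subtreeD(3) [OF tree] w(2) by blast
    with e(2) w(2) have "?p w \<noteq> e" by auto
    moreover have "?p v = e" if "v \<in> e" "v \<noteq> w" for v
      using unique [OF that(1)] that(2) by metis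
    ultimately have "{v\<in>e. ?p v \<noteq> e} = {w}" using w(1) by blast
    with True show ?thesis by blast
  next
    case False
    with that have "e' \<in> S" by simp
    then have "{v\<in>e'. ?p v \<noteq> e'} = {v\<in>e'. p v \<noteq> e'}" by auto
    with rooted_subtreeD(5) [OF tree \<open>e' \<in> S\<close> that(2)] show ?thesis by simp
  qed
  have new_old: "joined n (insert e S) u v" if uv: "u \<in> e" "u \<notin> \<Union>S" "v \<in> \<Union>S" for u v
  proof -
    obtain q vs es where path: "hyperpath n S q vs es" "set vs \<subseteq> \<Union>S" "vs ! 0 = w" "vs ! q = v"
      using rooted_subtreeD(6) [OF tree w(2) uv(3)] by (rule joinedE)
    have "hyperpath n (insert e S) (q + 1) (u # vs) (e # es)"
    proof (rule hyperpath_Cons [OF path(1) e(2) uv(1)])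
      show "vs ! 0 \<in> e" using path(3) w(1) by simp
      show "u \<notin> set vs" using path(2) uv(2) by blast
      show "u \<in> {1..n}" using uv(1) e(3) by blast
    qed
    with path uv(1) show ?thesis
      by (intro joinedI [of n _ "q + 1" "u # vs" "e # es"]) auto
  qed
  have joined: "joined n (insert e S) u v" if uv: "u \<in> \<Union>(insert e S)" "v \<in> \<Union>(insert e S)" for u v
  proof (cases "u \<in> \<Union>S"; cases "v \<in> \<Union>S")
    assume "u \<in> \<Union>S" "v \<in> \<Union>S"
    then show ?thesis
      using joined_mono [OF rooted_subtreeD(6) [OF tree]] by blast
  next
    assume "u \<in> \<Union>S" "v \<notin> \<Union>S"
    with uv(2) show ?thesis by (intro joined_sym [OF new_old]) simp_all
  next
    assume "u \<notin> \<Union>S" "v \<in> \<Union>S"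
    with uv(1) show ?thesis by (intro new_old) simp_all
  next
    assume "u \<notin> \<Union>S" "v \<notin> \<Union>S"
    with uv have "u \<in> e" "v \<in> e" by simp_all
    then show ?thesis by (intro joined_edge [OF e(3)]) simp_all
  qed
  have "f \<in> insert e S" "\<forall>v\<in>f. ?p v = f" "\<forall>v\<in>\<Union>(insert e S). ?p v \<in> insert e S \<and> v \<in> ?p v"
    using rooted_subtreeD(1-4) [OF tree] by auto
  with parent joined show ?thesis
    unfolding rooted_subtree_def by simp
qed

lemma supertree_cover:
  assumes "supertree n k E" and "E \<noteq> {}" and "k \<ge> 1"
  shows "\<Union>E = {1..n}"
proof
  show "\<Union>E \<subseteq> {1..n}" using supertreeD(3) [OF assms(1)] by blast
  from assms obtain e u where "e \<in> E" "u \<in> e"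
    using supertreeD(4) [OF assms(1)] by fastforce
  then show "{1..n} \<subseteq> \<Union>E"
    using supertreeD(7) [OF assms(1)]
    by (intro hyper_connected_closed [OF supertreeD(1) [OF assms(1)], of u]) blast+
qed

text \<open>
  Starting from \<open>f\<close>, edges are added one at a time; connectedness provides the next edge.
\<close>
lemma supertree_rooted:
  assumes T: "supertree n k E" and "k \<ge> 1" and f: "f \<in> E"
  obtains p where "rooted_subtree n f E p"
proof -
  note T' = supertreeD [OF T]
  have "\<exists>S p. S \<subseteq> E \<and> card S = Suc j \<and> rooted_subtree n f S p" if "Suc j \<le> card E" for j
    using that
  proof (induction j)
    case 0
    show ?case
      using rooted_subtree_singleton [OF T'(3) [OF f]] f
      by (intro exI [of _ "{f}"] exI [of _ "\<lambda>_. f"]) simp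
  next
    case (Suc j)
    then obtain S p where S: "S \<subseteq> E" "card S = Suc j" and tree: "rooted_subtree n f S p" by auto
    have "f \<in> S" using tree by (simp add: rooted_subtree_def)
    have "\<exists>e\<in>E. e \<notin> S \<and> e \<inter> \<Union>S \<noteq> {}"
    proof (rule ccontr)
      assume none: "\<not> ?thesis"
      obtain u where u: "u \<in> f" using T'(4) [OF f] \<open>k \<ge> 1\<close> by fastforce
      have "{1..n} \<subseteq> \<Union>S"
        using none u T'(7) f \<open>f \<in> S\<close> by (intro hyper_connected_closed [OF T'(1), of u]) blast+
      have "E \<subseteq> S"
      proof
        fix e assume "e \<in> E"
        then obtain v where "v \<in> e" using T'(4) \<open>k \<ge> 1\<close> by fastforce
        with \<open>e \<in> E\<close> T'(3) \<open>{1..n} \<subseteq> \<Union>S\<close> none show "e \<in> S" by blast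
      qed
      with S Suc.prems show False by (metis card_mono T'(6) finite_subset Suc_n_not_le_n le_trans)
    qed
    then obtain e where e: "e \<in> E" "e \<notin> S" "e \<inter> \<Union>S \<noteq> {}" by blast
    have "card (insert e S) = Suc (Suc j)"
      using e(2) S T'(6) by (simp add: finite_subset)
    with rooted_subtree_extend [OF tree T'(2) S(1) e(1,2) T'(3) [OF e(1)] e(3)] e(1) S(1)
    show ?case by (intro exI conjI) auto
  qed
  moreover have "Suc (card E - 1) = card E"
    using f T'(6) by (metis Suc_diff_1 card_gt_0_iff empty_iff)
  ultimately obtain S p where "S \<subseteq> E" "card S = card E" "rooted_subtree n f S p"
    by (metis le_refl)
  with T'(6) card_subset_eq that show thesis by metis
qed

text \<open>A vertex that lies on at least two edges.\<close>
definition branching :: "nat set set \<Rightarrow> nat \<Rightarrow> bool" where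
  "branching E v \<longleftrightarrow> (\<exists>e\<in>E. \<exists>e'\<in>E. e \<noteq> e' \<and> v \<in> e \<and> v \<in> e')"

text \<open>
  With the tree rooted at each edge \<open>f\<close> in turn, \<open>B v e\<close> is the fraction of the roots \<open>f\<close> for which
  \<open>e\<close> is the edge at \<open>v\<close> towards \<open>f\<close>.  Both sum conditions follow by double counting of pairs
  of a root and an edge, respectively a root and a vertex.
\<close>
theorem supertree_weights:
  assumes T: "supertree n k E" and k: "k \<ge> 1"
  obtains B :: "nat \<Rightarrow> nat set \<Rightarrow> real" where
    "\<And>e v. e \<in> E \<Longrightarrow> v \<in> e \<Longrightarrow> 0 < B v e \<and> B v e \<le> 1"
    and "\<And>v. v \<in> {1..n} \<Longrightarrow> (\<Sum>e | e \<in> E \<and> v \<in> e. B v e) \<le> 1"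
    and "\<And>e. e \<in> E \<Longrightarrow> (\<Sum>v\<in>e. 1 - B v e) = 1 - 1 / real (card E)"
    and "\<And>e v. e \<in> E \<Longrightarrow> v \<in> e \<Longrightarrow> branching E v \<Longrightarrow> B v e < 1"
proof -
  note T' = supertreeD [OF T]
  have "\<forall>f\<in>E. \<exists>p. rooted_subtree n f E p"
    using supertree_rooted [OF T k] by metis
  then obtain p where p: "\<And>f. f \<in> E \<Longrightarrow> rooted_subtree n f E (p f)" by metis
  have p_in: "p f v \<in> E" "v \<in> p f v" if "f \<in> E" "e \<in> E" "v \<in> e" for f e v
    using rooted_subtreeD(3,4) [OF p [OF that(1)] that(2,3)] .
  have p_root: "p f v = f" if "f \<in> E" "v \<in> f" for f v
    using rooted_subtreeD(2) [OF p [OF that(1)] that(2)] .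
  have p_one: "card {v\<in>e. p f v \<noteq> e} = 1" if "f \<in> E" "e \<in> E" "e \<noteq> f" for f e
  proof -
    have "\<exists>w. {v\<in>e. p f v \<noteq> e} = {w}"
      using rooted_subtreeD(5) [OF p [OF that(1)] that(2,3)] .
    then show ?thesis by auto
  qed
  define m where "m = real (card E)"
  define a where "a = (\<lambda>v e. card {f\<in>E. p f v = e})"
  have m_pos: "0 < m" if "e \<in> E" for e
    using that T'(6) by (auto simp: m_def card_gt_0_iff)
  have a_le: "a v e \<le> card E" for v e
    unfolding a_def by (intro card_mono T'(6)) auto
  have a_compl: "real (card E) - real (a v e) = real (card {f\<in>E. p f v \<noteq> e})" for v e
  proof -
    have "card E = card {f\<in>E. p f v = e} + card {f\<in>E. p f v \<noteq> e}"
      using T'(6) by (subst card_Un_disjoint [symmetric]) (auto intro: arg_cong [where f = card])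
    then show ?thesis by (simp add: a_def)
  qed
  show thesis
  proof
    fix e v assume ev: "e \<in> E" "v \<in> e"
    have "e \<in> {f\<in>E. p f v = e}" using ev p_root by simp
    then have "0 < a v e" using T'(6) by (auto simp: a_def card_gt_0_iff)
    then show "0 < a v e / m \<and> a v e / m \<le> 1"
      using m_pos [OF ev(1)] a_le [of v e] by (simp add: m_def)
    assume "branching E v"
    then obtain e' where e': "e' \<in> E" "e' \<noteq> e" "v \<in> e'" unfolding branching_def by metis
    then have "e' \<in> {f\<in>E. p f v \<noteq> e}" using p_root by simp
    then have "0 < card {f\<in>E. p f v \<noteq> e}" using T'(6) by (auto simp: card_gt_0_iff)
    then show "a v e / m < 1"
      using a_compl [of v e] m_pos [OF ev(1)] by (simp add: m_def)
  next
    fix v assume "v \<in> {1..n}"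
    have "(\<Sum>e | e \<in> E \<and> v \<in> e. a v e) = card (\<Union>e\<in>{e. e \<in> E \<and> v \<in> e}. {f\<in>E. p f v = e})"
      unfolding a_def using T'(6) by (subst card_UN_disjoint) auto
    also have "\<dots> \<le> card E" by (intro card_mono T'(6)) auto
    finally have "real (\<Sum>e | e \<in> E \<and> v \<in> e. a v e) \<le> m" unfolding m_def by (rule of_nat_mono)
    then have "(\<Sum>e | e \<in> E \<and> v \<in> e. real (a v e)) / m \<le> 1"
      by (auto simp: divide_le_eq_1 m_def)
    then show "(\<Sum>e | e \<in> E \<and> v \<in> e. a v e / m) \<le> 1" by (simp add: sum_divide_distrib)
  next
    fix e assume e: "e \<in> E"
    have "1 - a v e / m = real (card {f\<in>E. p f v \<noteq> e}) / m" for v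
      using m_pos [OF e] a_compl [of v e, symmetric] by (simp add: m_def field_simps)
    then have "(\<Sum>v\<in>e. 1 - a v e / m) = (\<Sum>v\<in>e. real (card {f\<in>E. p f v \<noteq> e})) / m"
      by (simp add: sum_divide_distrib)
    also have "(\<Sum>v\<in>e. real (card {f\<in>E. p f v \<noteq> e})) = real (\<Sum>f\<in>E. card {v\<in>e. p f v \<noteq> e})"
      using sum.swap_restrict [OF T'(5) [OF e] T'(6), of "\<lambda>_ _. 1::nat" "\<lambda>v f. p f v \<noteq> e"]
      by (simp flip: of_nat_sum)
    also have "(\<Sum>f\<in>E. card {v\<in>e. p f v \<noteq> e}) = (\<Sum>f\<in>E - {e}. 1)"
    proof -
      have root: "{v\<in>e. p e v \<noteq> e} = {}" using p_root [OF e] by blast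
      have rest: "(\<Sum>f\<in>E - {e}. card {v\<in>e. p f v \<noteq> e}) = (\<Sum>f\<in>E - {e}. 1)"
        by (intro sum.cong refl p_one) (use e in auto)
      show ?thesis
        by (simp only: sum.remove [OF T'(6) e] root rest card.empty add_0)
    qed
    also have "real \<dots> / m = 1 - 1 / real (card E)"
      using e T'(6) m_pos [OF e] by (simp add: m_def field_simps of_nat_diff Suc_leI card_gt_0_iff)
    finally show "(\<Sum>v\<in>e. 1 - a v e / m) = 1 - 1 / real (card E)" .
  qed
qed

text \<open>
  If every edge had at most one branching vertex, the edges through such a vertex \<open>c\<close> (or through any
  vertex, when there is none) would form a set that no other edge meets, so by connectedness all edges
  would contain \<open>c\<close>.
\<close>
lemma not_star_edge:
  assumes T: "supertree n k E" and "k \<ge> 1" and "E \<noteq> {}"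
    and not_star: "\<not> (\<exists>c\<in>{1..n}. \<forall>e\<in>E. c \<in> e)"
  obtains e u v where "e \<in> E" "u \<in> e" "v \<in> e" "u \<noteq> v" "branching E u" "branching E v"
proof (rule ccontr)
  assume "\<not> thesis"
  with that have one: "\<And>e u v. \<lbrakk>e \<in> E; u \<in> e; v \<in> e; branching E u; branching E v\<rbrakk> \<Longrightarrow> u = v"
    by blast
  note T' = supertreeD [OF T]
  have "\<exists>c\<in>\<Union>E. branching E c \<or> (\<forall>v. \<not> branching E v)"
  proof (cases "\<exists>v. branching E v")
    case True
    then show ?thesis unfolding branching_def by blast
  next
    case False
    obtain e where "e \<in> E" using assms(3) by blast
    with T'(4) [OF this] assms(2) have "e \<noteq> {}" by auto
    with \<open>e \<in> E\<close> False show ?thesis by blast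
  qed
  then obtain c where c: "c \<in> \<Union>E" "branching E c \<or> (\<forall>v. \<not> branching E v)" by blast
  have step: "c \<in> e" if e: "e \<in> E" "e' \<in> E" "c \<in> e'" "v \<in> e" "v \<in> e'" for e e' v
  proof (cases "e = e'")
    case False
    with e have "branching E v" unfolding branching_def by blast
    with c(2) one [OF e(2,5,3)] e(4) show ?thesis by blast
  qed (use e in simp)
  have "{1..n} \<subseteq> \<Union>{e\<in>E. c \<in> e}"
    using c(1) T'(7) step by (intro hyper_connected_closed [OF T'(1), of c]) blast+
  moreover have nonempty: "e \<noteq> {}" if "e \<in> E" for e using T'(4) [OF that] assms(2) by auto
  ultimately have "c \<in> e" if e: "e \<in> E" for e
  proof -
    obtain v where "v \<in> e" using nonempty [OF e] by blast
    moreover obtain e' where "e' \<in> E" "c \<in> e'" "v \<in> e'"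
      using T'(7) [OF e \<open>v \<in> e\<close>] \<open>{1..n} \<subseteq> \<Union>{e\<in>E. c \<in> e}\<close> by blast
    ultimately show ?thesis using step e by blast
  qed
  with not_star c(1) T'(7) show False by blast
qed

lemma supertree_common_vertex_inter:
  assumes T: "supertree n k E" and c: "\<forall>e\<in>E. c \<in> e" and e: "e \<in> E" "e' \<in> E" "e \<noteq> e'"
  shows "e \<inter> e' = {c}"
proof -
  note T' = supertreeD [OF T]
  have "u = c" if "u \<in> e" "u \<in> e'" for u
  proof (rule ccontr)
    assume "u \<noteq> c"
    with that c e T'(3) have path: "hyperpath n {e} 1 [u, c] [e]"
      by (intro hyperpath_edge) auto
    have "[u, c] ! 0 = [u, c] ! 1"
      by (rule hyper_acyclic_no_chord [OF T'(2) path _ e(2)]) (use that c e in auto)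
    with \<open>u \<noteq> c\<close> show False by simp
  qed
  with c e show ?thesis by auto
qed

lemma supertree_common_vertex_order:
  assumes T: "supertree n k E" and "k \<ge> 1" and "E \<noteq> {}" and c: "\<forall>e\<in>E. c \<in> e"
  shows "n = card E * (k - 1) + 1"
proof -
  note T' = supertreeD [OF T]
  have "\<Union>E = insert c (\<Union>e\<in>E. e - {c})"
    using c assms(3) by blast
  then have "{1..n} = insert c (\<Union>e\<in>E. e - {c})"
    using supertree_cover [OF T assms(3,2)] by simp
  then have "n = card (insert c (\<Union>e\<in>E. e - {c}))" by (metis card_atLeastAtMost diff_Suc_1)
  also have "\<dots> = Suc (card (\<Union>e\<in>E. e - {c}))"
    using T'(5,6) by (subst card_insert_disjoint) auto
  also have "card (\<Union>e\<in>E. e - {c}) = (\<Sum>e\<in>E. card (e - {c}))"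
    using T'(5,6) supertree_common_vertex_inter [OF T c] by (intro card_UN_disjoint) auto
  also have "\<dots> = card E * (k - 1)"
    using c T'(4,5) by (simp add: card_Diff_singleton)
  finally show ?thesis by simp
qed

lemma hyperstar_common_vertex:
  assumes "hyperstar n k m S"
  shows "\<exists>d\<in>{1..n}. \<forall>e\<in>S. d \<in> e"
proof -
  obtain P where P: "(\<Union>i\<in>{0..m}. P i) = {1..n} \<and> disjoint_family_on P {0..m} \<and>
      card (P 0) = 1 \<and> (\<forall>i\<in>{1..m}. card (P i) = k - 1) \<and> S = {P 0 \<union> P i | i. i \<in> {1..m}}"
    using assms unfolding hyperstar_def by (elim conjE) (erule exE, erule that)
  then obtain d where d: "P 0 = {d}" by (auto simp: card_1_singleton_iff)
  moreover have "P 0 \<subseteq> {1..n}" using P by force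
  ultimately show ?thesis using P by blast
qed

text \<open>
  In the direction from right to left, \<open>E\<close> is itself a hyperstar: acyclicity forces distinct edges to
  meet only in the common vertex.
\<close>
lemma isomorphic_hyperstar_iff:
  assumes T: "supertree n k E" and "k \<ge> 1" and m: "card E = m" "m \<ge> 1"
  shows "(\<exists>S. hyperstar n k m S \<and> hypergraph_isomorphic n E n S)
     \<longleftrightarrow> (\<exists>c\<in>{1..n}. \<forall>e\<in>E. c \<in> e)"
proof
  assume "\<exists>S. hyperstar n k m S \<and> hypergraph_isomorphic n E n S"
  then obtain S where S: "hyperstar n k m S" and iso: "hypergraph_isomorphic n E n S" by blast
  from iso obtain f where f: "bij_betw f {1..n} {1..n}" "S = (\<lambda>e. f ` e) ` E"
    unfolding hypergraph_isomorphic_def by blast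
  from hyperstar_common_vertex [OF S] obtain d where d: "d \<in> {1..n}" "\<forall>e\<in>S. d \<in> e" by blast
  obtain c where c: "c \<in> {1..n}" "f c = d" using f(1) d(1) by (metis bij_betw_iff_bijections)
  have "c \<in> e" if "e \<in> E" for e
  proof -
    have "d \<in> f ` e" using that f(2) d by blast
    then obtain u where "u \<in> e" "f u = d" by blast
    with c f(1) supertreeD(3) [OF T that] show ?thesis
      by (metis bij_betw_def inj_onD subsetD)
  qed
  with c(1) show "\<exists>c\<in>{1..n}. \<forall>e\<in>E. c \<in> e" by blast
next
  assume "\<exists>c\<in>{1..n}. \<forall>e\<in>E. c \<in> e"
  then obtain c where c: "c \<in> {1..n}" "\<forall>e\<in>E. c \<in> e" by blast
  note T' = supertreeD [OF T]
  have "E \<noteq> {}" using m by auto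
  obtain h where h: "bij_betw h {1..m} E"
    using ex_bij_betw_nat_finite_1 [OF T'(6)] m(1) by blast
  then have hE: "h i \<in> E" if "i \<in> {1..m}" for i
    using that by (auto simp: bij_betw_def)
  define P where "P = (\<lambda>i. if i = 0 then {c} else h i - {c})"
  have P_edge: "P 0 \<union> P i = h i" if "i \<in> {1..m}" for i
    using that c(2) hE by (auto simp: P_def)
  have E_eq: "E = {P 0 \<union> P i | i. i \<in> {1..m}}"
  proof -
    have "{P 0 \<union> P i | i. i \<in> {1..m}} = (\<lambda>i. P 0 \<union> P i) ` {1..m}" by blast
    also have "\<dots> = h ` {1..m}" by (intro image_cong refl P_edge)
    finally have "{P 0 \<union> P i | i. i \<in> {1..m}} = h ` {1..m}" .
    with h show ?thesis by (simp add: bij_betw_def)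
  qed
  have cover: "(\<Union>i\<in>{0..m}. P i) = {1..n}"
  proof -
    have "(\<Union>i\<in>{0..m}. P i) = (\<Union>i\<in>{1..m}. P 0 \<union> P i)"
    proof -
      have split: "{0..m} = insert 0 {1..m}" and "1 \<in> {1..m}" using m(2) by auto
      from this(2) show ?thesis unfolding split by blast
    qed
    also have "\<dots> = \<Union>E" unfolding E_eq by blast
    finally show ?thesis using supertree_cover [OF T \<open>E \<noteq> {}\<close> assms(2)] by simp
  qed
  have "P i \<inter> P j = {}" if "i \<in> {0..m}" "j \<in> {0..m}" "i \<noteq> j" for i j
  proof (cases "i = 0 \<or> j = 0")
    case True
    with that show ?thesis by (auto simp: P_def)
  next
    case False
    with that have ij: "i \<in> {1..m}" "j \<in> {1..m}" by auto
    with h that(3) have "h i \<noteq> h j" by (metis bij_betw_def inj_onD)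
    from supertree_common_vertex_inter [OF T c(2) hE [OF ij(1)] hE [OF ij(2)] this] False
    show ?thesis by (auto simp: P_def)
  qed
  then have "disjoint_family_on P {0..m}" by (simp add: disjoint_family_on_def)
  moreover have "\<forall>i\<in>{1..m}. card (P i) = k - 1"
    using hE c(2) T'(4) by (simp add: P_def card_Diff_singleton)
  moreover have "card (P 0) = 1" by (simp add: P_def)
  ultimately have "hyperstar n k m E"
    unfolding hyperstar_def
    using cover E_eq m(1) T supertree_common_vertex_order [OF T assms(2) \<open>E \<noteq> {}\<close> c(2)]
    by (auto simp: supertree_def)
  moreover have "hypergraph_isomorphic n E n E"
    unfolding hypergraph_isomorphic_def by (intro exI [of _ id]) auto
  ultimately show "\<exists>S. hyperstar n k m S \<and> hypergraph_isomorphic n E n S" by blast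
qed

section \<open>The forms of the hypergraph tensors\<close>

lemma tensor_form_degree:
  assumes "k \<ge> 1"
  shows "tensor_form k n (degree_tensor E) x = (\<Sum>i\<in>{1..n}. real (Defs.degree E i) * x i ^ k)"
proof -
  have zero: "tensor_form p n (\<lambda>_. 0) x = 0" for p
    by (simp add: tensor_form_def)
  \<comment> \<open>The condition \<open>Q\<close> absorbs the comparison of the leading index with \<open>i\<close> in the induction.\<close>
  have aux: "tensor_form p n (\<lambda>js. if Q \<and> (\<forall>j\<in>set js. j = i) then d else 0) x
      = (if Q then d * x i ^ p else 0)" if "i \<in> {1..n}" for Q p i and d :: real
  proof (induction p arbitrary: Q)
    case (Suc p)
    have "(\<lambda>js. if Q \<and> (\<forall>j\<in>set (j' # js). j = i) then d else 0)
        = (\<lambda>js. if (Q \<and> j' = i) \<and> (\<forall>j\<in>set js. j = i) then d else 0)" for j'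
      by auto
    then show ?case
      using that unfolding tensor_form_Suc
      by (cases Q) (simp_all add: Suc.IH zero if_distrib [of "\<lambda>u. _ * u"] cong: if_cong)
  qed (simp add: tensor_form_0)
  obtain p where p: "k = Suc p" using assms by (cases k) auto
  have "tensor_form p n (\<lambda>js. degree_tensor E (i # js)) x = real (Defs.degree E i) * x i ^ p"
    if "i \<in> {1..n}" for i
  proof -
    have "(\<lambda>js. degree_tensor E (i # js))
        = (\<lambda>js. if True \<and> (\<forall>j\<in>set js. j = i) then real (Defs.degree E i) else 0)"
      by (rule ext) (simp add: degree_tensor_def)
    then show ?thesis
      using aux [OF that, of p True] by simp
  qed
  then show ?thesis
    unfolding p tensor_form_Suc by (intro sum.cong refl) (simp add: mult_ac)
qed

lemma sum_degree:
  fixes y :: "nat \<Rightarrow> real"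
  assumes "finite E" "\<And>e. e \<in> E \<Longrightarrow> e \<subseteq> {1..n}"
  shows "(\<Sum>i\<in>{1..n}. real (Defs.degree E i) * y i) = (\<Sum>e\<in>E. \<Sum>i\<in>e. y i)"
proof -
  have "(\<Sum>i\<in>{1..n}. real (Defs.degree E i) * y i) = (\<Sum>i\<in>{1..n}. \<Sum>e | e \<in> E \<and> i \<in> e. y i)"
    by (simp add: Defs.degree_def)
  also have "\<dots> = (\<Sum>e\<in>E. \<Sum>i | i \<in> {1..n} \<and> i \<in> e. y i)"
    by (rule sum.swap_restrict) (use assms in auto)
  also have "\<dots> = (\<Sum>e\<in>E. \<Sum>i\<in>e. y i)"
    by (intro sum.cong refl) (use assms(2) in blast)
  finally show ?thesis .
qed

lemma finite_lists_of_length: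
  assumes "finite A"
  shows "finite {js. length js = p \<and> set js \<subseteq> A}"
proof -
  have "{js. length js = p \<and> set js \<subseteq> A} = {js. set js \<subseteq> A \<and> length js = p}" by blast
  then show ?thesis using finite_lists_length_eq [OF assms, of p] by simp
qed

text \<open>
  The index lists of length \<open>k\<close> whose set is an edge \<open>e\<close> are the \<open>k!\<close> orderings of \<open>e\<close>, and
  \<open>k! / (k-1)! = k\<close>.
\<close>
lemma tensor_form_adjacency:
  assumes "finite E" "\<And>e. e \<in> E \<Longrightarrow> e \<subseteq> {1..n}" "\<And>e. e \<in> E \<Longrightarrow> card e = k" "k \<ge> 1"
  shows "tensor_form k n (adjacency_tensor k E) x = (\<Sum>e\<in>E. real k * (\<Prod>v\<in>e. x v))"
proof -
  have fin: "finite e" if "e \<in> E" for e using assms(2) [OF that] finite_subset by blast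
  let ?L = "{js. length js = k \<and> set js \<subseteq> {1..n}}"
  have L: "{js \<in> ?L. set js \<in> E} = (\<Union>e\<in>E. permutations_of_set e)"
  proof (intro equalityI subsetI)
    fix js assume "js \<in> {js \<in> ?L. set js \<in> E}"
    then have "set js \<in> E" "length js = card (set js)" using assms(3) by auto
    then show "js \<in> (\<Union>e\<in>E. permutations_of_set e)"
      by (auto simp: permutations_of_set_def card_distinct)
  next
    fix js assume "js \<in> (\<Union>e\<in>E. permutations_of_set e)"
    then obtain e where "e \<in> E" "set js = e" "distinct js" by (auto simp: permutations_of_set_def)
    then show "js \<in> {js \<in> ?L. set js \<in> E}"
      using assms(2,3) by (auto simp flip: distinct_card)
  qed
  have "tensor_form k n (adjacency_tensor k E) x
      = (\<Sum>js \<in> {js \<in> ?L. set js \<in> E}. 1 / fact (k - 1) * (\<Prod>j\<leftarrow>js. x j))"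
    unfolding tensor_form_def adjacency_tensor_def
    by (subst sum.inter_filter) (auto simp: finite_lists_of_length intro!: sum.cong)
  also have "\<dots> = (\<Sum>e\<in>E. \<Sum>js\<in>permutations_of_set e. 1 / fact (k - 1) * (\<Prod>j\<leftarrow>js. x j))"
    unfolding L using assms(1)
    by (intro sum.UNION_disjoint ballI impI finite_permutations_of_set)
      (auto simp: permutations_of_set_def)
  also have "\<dots> = (\<Sum>e\<in>E. real k * (\<Prod>v\<in>e. x v))"
  proof (intro sum.cong refl)
    fix e assume e: "e \<in> E"
    have "(\<Sum>js\<in>permutations_of_set e. 1 / fact (k - 1) * (\<Prod>j\<leftarrow>js. x j))
        = (\<Sum>js\<in>permutations_of_set e. 1 / fact (k - 1) * (\<Prod>v\<in>e. x v))"
      by (intro sum.cong refl)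
        (auto simp: permutations_of_set_def prod.distinct_set_conv_list)
    also have "\<dots> = real k * (\<Prod>v\<in>e. x v)"
      using fin [OF e] assms(3) [OF e] assms(4) by (simp add: fact_reduce [of k])
    finally show "(\<Sum>js\<in>permutations_of_set e. 1 / fact (k - 1) * (\<Prod>j\<leftarrow>js. x j)) = \<dots>" .
  qed
  finally show ?thesis .
qed

lemma tensor_form_signless_laplacian:
  assumes "finite E" "\<And>e. e \<in> E \<Longrightarrow> e \<subseteq> {1..n}" "\<And>e. e \<in> E \<Longrightarrow> card e = k" "k \<ge> 1"
  shows "tensor_form k n (signless_laplacian_tensor k E) x
     = (\<Sum>e\<in>E. (\<Sum>v\<in>e. x v ^ k) + real k * (\<Prod>v\<in>e. x v))"
proof -
  have "tensor_form k n (signless_laplacian_tensor k E) x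
      = tensor_form k n (degree_tensor E) x + tensor_form k n (adjacency_tensor k E) x"
    by (simp add: tensor_form_def signless_laplacian_tensor_def distrib_right sum.distrib)
  then show ?thesis
    using assms by (simp only: tensor_form_degree tensor_form_adjacency sum_degree sum.distrib)
qed

lemma tensor_form_incidence_Q:
  assumes "finite E" "\<And>e. e \<in> E \<Longrightarrow> e \<subseteq> {1..n}"
  shows "tensor_form k n (incidence_Q_tensor E) x = (\<Sum>e\<in>E. (\<Sum>v\<in>e. x v) ^ k)"
proof -
  let ?L = "{js. length js = k \<and> set js \<subseteq> {1..n}}"
  have "tensor_form k n (incidence_Q_tensor E) x
      = (\<Sum>js\<in>?L. \<Sum>e | e \<in> E \<and> set js \<subseteq> e. \<Prod>j\<leftarrow>js. x j)"
    by (simp add: tensor_form_def incidence_Q_tensor_def subset_eq)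
  also have "\<dots> = (\<Sum>e\<in>E. \<Sum>js | js \<in> ?L \<and> set js \<subseteq> e. \<Prod>j\<leftarrow>js. x j)"
    by (rule sum.swap_restrict [OF finite_lists_of_length assms(1)]) simp
  also have "\<dots> = (\<Sum>e\<in>E. \<Sum>js \<in> {js. length js = k \<and> set js \<subseteq> e}. \<Prod>j\<leftarrow>js. x j)"
    using assms(2) by (intro sum.cong refl) blast
  finally show ?thesis by (simp only: sum_lists_prod_list)
qed

lemma symmetric_adjacency: "symmetric_tensor (adjacency_tensor k E)"
  unfolding symmetric_tensor_def adjacency_tensor_def by (metis mset_eq_setD)

lemma symmetric_incidence_Q: "symmetric_tensor (incidence_Q_tensor E)"
  unfolding symmetric_tensor_def
proof (intro allI impI)
  fix js js' :: "nat list"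
  assume "mset js = mset js'"
  then have "set js = set js'" by (rule mset_eq_setD)
  then show "incidence_Q_tensor E js = incidence_Q_tensor E js'"
    by (simp only: incidence_Q_tensor_def)
qed

lemma symmetric_degree: "symmetric_tensor (degree_tensor E)"
  unfolding symmetric_tensor_def
proof (intro allI impI)
  fix js js' :: "nat list"
  assume eq: "mset js = mset js'"
  then have set: "set js = set js'" by (rule mset_eq_setD)
  show "degree_tensor E js = degree_tensor E js'"
  proof (cases "js = []")
    case False
    with eq have "js' \<noteq> []" by auto
    with False set have hd: "hd js \<in> set js'" "hd js' \<in> set js"
      by (metis hd_in_set)+
    show ?thesis
    proof (cases "\<forall>j\<in>set js. j = hd js")
      case True
      with hd have "hd js' = hd js" by blast
      with set show ?thesis by (simp add: degree_tensor_def)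
    next
      case False
      with hd set have "\<not> (\<forall>j\<in>set js'. j = hd js')" by metis
      with False show ?thesis by (simp only: degree_tensor_def if_False)
    qed
  qed (use eq in simp)
qed

lemma symmetric_signless_laplacian: "symmetric_tensor (signless_laplacian_tensor k E)"
  unfolding symmetric_tensor_def
proof (intro allI impI)
  fix js js' :: "nat list"
  assume eq: "mset js = mset js'"
  have "degree_tensor E js = degree_tensor E js'"
    using symmetric_degree eq unfolding symmetric_tensor_def by blast
  moreover have "adjacency_tensor k E js = adjacency_tensor k E js'"
    using symmetric_adjacency eq unfolding symmetric_tensor_def by blast
  ultimately show "signless_laplacian_tensor k E js = signless_laplacian_tensor k E js'"
    by (simp only: signless_laplacian_tensor_def)
qed

text \<open>
  The common part of the three bounds.  The form of the tensor is a sum of contributions \<open>F e\<close> of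
  the edges, and each \<open>F e x\<close> is at most \<open>\<mu> \<Sum>\<^bsub>v\<in>e\<^esub> B v e x\<^sub>v\<^sup>k\<close>.  This must be strict if \<open>x\<close> has
  both zero and positive entries on \<open>e\<close>, and also if \<open>x\<close> is positive on \<open>e\<close> and two of the weights
  at \<open>e\<close> are below \<open>1\<close>.  The last assumption provides a vector that attains \<open>\<mu>\<close> in a hyperstar.
\<close>
lemma spectral_radius_le_weighted:
  fixes F :: "nat set \<Rightarrow> (nat \<Rightarrow> real) \<Rightarrow> real" and B :: "nat \<Rightarrow> nat set \<Rightarrow> real"
  assumes k: "k \<ge> 2" and T: "supertree n k E" and E: "E \<noteq> {}"
    and sym: "symmetric_tensor A" and nonneg: "\<And>js. 0 \<le> A js"
    and form: "\<And>x. tensor_form k n A x = (\<Sum>e\<in>E. F e x)"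
    and \<mu>: "0 \<le> \<mu>"
    and B: "\<And>v. v \<in> {1..n} \<Longrightarrow> (\<Sum>e | e \<in> E \<and> v \<in> e. B v e) \<le> 1"
    and B_branching: "\<And>e v. e \<in> E \<Longrightarrow> v \<in> e \<Longrightarrow> branching E v \<Longrightarrow> B v e < 1"
    and le: "\<And>e x. e \<in> E \<Longrightarrow> (\<And>v. 0 \<le> x v) \<Longrightarrow> F e x \<le> \<mu> * (\<Sum>v\<in>e. B v e * x v ^ k)"
    and less_mixed: "\<And>e x u w. \<lbrakk>e \<in> E; \<And>v. 0 \<le> x v; u \<in> e; x u = 0; w \<in> e; 0 < x w\<rbrakk>
        \<Longrightarrow> F e x < \<mu> * (\<Sum>v\<in>e. B v e * x v ^ k)"
    and less_branching: "\<And>e x u w. \<lbrakk>e \<in> E; \<And>v. v \<in> e \<Longrightarrow> 0 < x v;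
        u \<in> e; w \<in> e; u \<noteq> w; B u e < 1; B w e < 1\<rbrakk>
        \<Longrightarrow> F e x < \<mu> * (\<Sum>v\<in>e. B v e * x v ^ k)"
    and star: "\<And>c. \<lbrakk>c \<in> {1..n}; \<forall>e\<in>E. c \<in> e; n = card E * (k - 1) + 1\<rbrakk> \<Longrightarrow>
        \<exists>y. (\<forall>v. 0 < y v) \<and> (\<Sum>e\<in>E. F e y) = \<mu> * (\<Sum>v\<in>{1..n}. y v ^ k)"
  shows "spectral_radius k n A \<le> \<mu> \<and>
    (spectral_radius k n A = \<mu> \<longleftrightarrow> (\<exists>c\<in>{1..n}. \<forall>e\<in>E. c \<in> e))"
proof -
  note T' = supertreeD [OF T]
  have "k \<ge> 1" using k by simp
  have n: "n \<ge> 1"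
  proof -
    have "\<Union>E \<noteq> {}" using E T'(4) k by fastforce
    then show ?thesis using supertree_cover [OF T E \<open>k \<ge> 1\<close>] by simp
  qed
  obtain x where x0: "\<And>i. 0 \<le> x i" and x1: "(\<Sum>i\<in>{1..n}. x i ^ k) = 1"
    and \<rho>: "tensor_form k n A x = spectral_radius k n A"
    and max: "\<And>y. (\<And>i. i \<in> {1..n} \<Longrightarrow> 0 \<le> y i) \<Longrightarrow>
           tensor_form k n A y \<le> spectral_radius k n A * (\<Sum>i\<in>{1..n}. y i ^ k)"
    using spectral_radius_symmetric_nonneg [OF k n sym nonneg] by blast
  define W where "W = (\<lambda>e. \<mu> * (\<Sum>v\<in>e. B v e * x v ^ k))"
  have W_sum: "(\<Sum>e\<in>E. W e) \<le> \<mu>"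
  proof -
    have "(\<Sum>e\<in>E. \<Sum>v\<in>e. B v e * x v ^ k) = (\<Sum>e\<in>E. \<Sum>v | v \<in> {1..n} \<and> v \<in> e. B v e * x v ^ k)"
      using T'(3) by (intro sum.cong refl) blast
    also have "\<dots> = (\<Sum>v\<in>{1..n}. \<Sum>e | e \<in> E \<and> v \<in> e. B v e * x v ^ k)"
      by (rule sum.swap_restrict [symmetric]) (use T'(6) in auto)
    also have "\<dots> = (\<Sum>v\<in>{1..n}. (\<Sum>e | e \<in> E \<and> v \<in> e. B v e) * x v ^ k)"
      by (simp add: sum_distrib_right)
    also have "\<dots> \<le> (\<Sum>v\<in>{1..n}. 1 * x v ^ k)"
      using B x0 by (intro sum_mono mult_right_mono) auto
    also have "\<dots> = 1" using x1 by simp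
    finally have "\<mu> * (\<Sum>e\<in>E. \<Sum>v\<in>e. B v e * x v ^ k) \<le> \<mu> * 1"
      using \<mu> by (rule mult_left_mono)
    then show ?thesis by (simp add: W_def sum_distrib_left)
  qed
  have F_le: "F e x \<le> W e" if "e \<in> E" for e
    unfolding W_def using that x0 by (rule le)
  have "spectral_radius k n A = (\<Sum>e\<in>E. F e x)" using \<rho> form by simp
  also have "\<dots> \<le> (\<Sum>e\<in>E. W e)" by (intro sum_mono F_le)
  finally have rho_le: "spectral_radius k n A \<le> \<mu>" using W_sum by linarith
  have strict: "spectral_radius k n A < \<mu>" if "e \<in> E" "F e x < W e" for e
  proof -
    have "(\<Sum>e\<in>E. F e x) < (\<Sum>e\<in>E. W e)"
      using that F_le T'(6) by (intro sum_strict_mono_ex1) auto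
    then show ?thesis using \<rho> form W_sum by simp
  qed
  have not_star: "spectral_radius k n A < \<mu>" if ns: "\<not> (\<exists>c\<in>{1..n}. \<forall>e\<in>E. c \<in> e)"
  proof (cases "\<forall>v\<in>{1..n}. 0 < x v")
    case True
    obtain e u w where "e \<in> E" "u \<in> e" "w \<in> e" "u \<noteq> w" "branching E u" "branching E w"
      using not_star_edge [OF T \<open>k \<ge> 1\<close> E ns] by blast
    moreover have "F e x < W e"
      unfolding W_def
      using True T'(7) calculation B_branching by (intro less_branching [of e x u w]) auto
    ultimately show ?thesis using strict by blast
  next
    case False
    then obtain z where z: "z \<in> {1..n}" "\<not> 0 < x z" by blast
    have "\<exists>e\<in>E. e \<inter> {v. 0 < x v} \<noteq> {} \<and> \<not> e \<subseteq> {v. 0 < x v}"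
    proof (rule ccontr)
      assume none: "\<not> ?thesis"
      have "\<exists>w\<in>{1..n}. 0 < x w"
      proof (rule ccontr)
        assume "\<not> ?thesis"
        then have "x i = 0" if "i \<in> {1..n}" for i using x0 [of i] that by force
        then have "(\<Sum>i\<in>{1..n}. x i ^ k) = 0" using k by (simp add: power_0_left)
        with x1 show False by simp
      qed
      then obtain w where w: "w \<in> {1..n}" "w \<in> {v. 0 < x v}" by blast
      have "{1..n} \<subseteq> {v. 0 < x v}"
        using none by (intro hyper_connected_closed [OF T'(1) w]) blast
      with z show False by blast
    qed
    then obtain e u w where e: "e \<in> E" "w \<in> e" "0 < x w" "u \<in> e" "\<not> 0 < x u" by blast
    then have "x u = 0" using x0 [of u] by simp
    with e have "F e x < W e"
      unfolding W_def using x0 by (intro less_mixed [of e x u w]) auto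
    with e(1) show ?thesis by (rule strict)
  qed
  have "\<mu> \<le> spectral_radius k n A" if c: "c \<in> {1..n}" "\<forall>e\<in>E. c \<in> e" for c
  proof -
    obtain y where y: "\<And>v. 0 < y v" "(\<Sum>e\<in>E. F e y) = \<mu> * (\<Sum>v\<in>{1..n}. y v ^ k)"
      using star [OF c supertree_common_vertex_order [OF T \<open>k \<ge> 1\<close> E c(2)]] by blast
    have "0 < (\<Sum>v\<in>{1..n}. y v ^ k)"
      using y(1) n by (intro sum_pos) auto
    moreover have "\<mu> * (\<Sum>v\<in>{1..n}. y v ^ k) \<le> spectral_radius k n A * (\<Sum>v\<in>{1..n}. y v ^ k)"
      using max [of y] y(1) by (simp add: form y(2) less_imp_le)
    ultimately show ?thesis by simp
  qed
  then have "spectral_radius k n A = \<mu>" if "\<exists>c\<in>{1..n}. \<forall>e\<in>E. c \<in> e"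
    using that rho_le by (meson antisym)
  moreover have "\<exists>c\<in>{1..n}. \<forall>e\<in>E. c \<in> e" if "spectral_radius k n A = \<mu>"
    using not_star that by (metis less_irrefl)
  ultimately show ?thesis using rho_le by (intro conjI iffI)
qed

section \<open>Inequalities on a single edge\<close>

lemma one_plus_sum_le_prod:
  fixes f :: "'a \<Rightarrow> real"
  assumes "finite S" "\<And>v. v \<in> S \<Longrightarrow> 0 \<le> f v"
  shows "1 + (\<Sum>v\<in>S. f v) \<le> (\<Prod>v\<in>S. 1 + f v)"
  using assms
proof (induction S)
  case (insert v S)
  then have "(1 + f v) * (1 + (\<Sum>v\<in>S. f v)) \<le> (1 + f v) * (\<Prod>v\<in>S. 1 + f v)"
    by (intro mult_left_mono) auto
  moreover have "0 \<le> f v * (\<Sum>v\<in>S. f v)"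
    using insert.prems by (intro mult_nonneg_nonneg sum_nonneg) auto
  ultimately show ?case using insert.hyps by (simp add: algebra_simps)
qed simp

text \<open>Two positive terms \<open>t u\<close> and \<open>t w\<close> contribute the positive product \<open>t u * t w\<close>.\<close>
lemma Weierstrass_prod_ineq_strict:
  fixes t :: "'a \<Rightarrow> real"
  assumes fin: "finite S" and t: "\<And>v. v \<in> S \<Longrightarrow> 0 \<le> t v" and lt1: "(\<Sum>v\<in>S. t v) < 1"
    and u: "u \<in> S" "0 < t u" and w: "w \<in> S" "0 < t w" and "u \<noteq> w"
  shows "1 - (\<Sum>v\<in>S. t v) < (\<Prod>v\<in>S. 1 - t v)"
proof -
  define R where "R = S - {u} - {w}"
  define s where "s = (\<Sum>v\<in>R. t v)"
  define P where "P = (\<Prod>v\<in>R. 1 - t v)"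
  have S: "(\<Sum>v\<in>S. t v) = t u + (t w + s)" "(\<Prod>v\<in>S. 1 - t v) = (1 - t u) * ((1 - t w) * P)"
    using fin u(1) w(1) \<open>u \<noteq> w\<close>
    by (simp_all add: s_def P_def R_def sum.remove [of S u] sum.remove [of "S - {u}" w]
        prod.remove [of S u] prod.remove [of "S - {u}" w])
  have s0: "0 \<le> s" unfolding s_def R_def by (intro sum_nonneg t) auto
  have "t v \<le> 1" if "v \<in> S" for v
    using member_le_sum [OF that, of t] t fin lt1 by fastforce
  then have "1 - s \<le> P"
    unfolding s_def P_def R_def using t by (intro Weierstrass_prod_ineq) auto
  then have P: "0 < P" "1 - s \<le> P" using lt1 S(1) u(2) w(2) by auto
  have "1 - (t u + (t w + s)) \<le> (1 - t u - t w) * (1 - s)"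
    using s0 u(2) w(2) by (simp add: algebra_simps)
  also have "\<dots> \<le> (1 - t u - t w) * P"
    using P(2) lt1 S(1) s0 by (intro mult_left_mono) auto
  also have "\<dots> < (1 - t u - t w) * P + t u * t w * P"
    using u(2) w(2) P(1) by simp
  also have "\<dots> = (1 - t u) * ((1 - t w) * P)" by (simp add: algebra_simps)
  finally show ?thesis unfolding S .
qed

lemma weighted_arith_geom_mean:
  fixes C x :: "'a \<Rightarrow> real"
  assumes fin: "finite e" and k: "card e = k" "k \<ge> 1"
    and C: "\<And>v. v \<in> e \<Longrightarrow> 0 < C v" and x: "\<And>v. v \<in> e \<Longrightarrow> 0 \<le> x v"
  shows "1 \<le> (\<Prod>v\<in>e. C v) \<Longrightarrow> real k * (\<Prod>v\<in>e. x v) \<le> (\<Sum>v\<in>e. C v * x v ^ k)"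
    and "1 < (\<Prod>v\<in>e. C v) \<Longrightarrow> (\<And>v. v \<in> e \<Longrightarrow> 0 < x v) \<Longrightarrow>
           real k * (\<Prod>v\<in>e. x v) < (\<Sum>v\<in>e. C v * x v ^ k)"
proof -
  have "e \<noteq> {}" using k by auto
  let ?X = "\<Prod>v\<in>e. x v"
  have X0: "0 \<le> ?X" by (intro prod_nonneg) (use x in auto)
  have root: "(?X ^ k) powr (1 / real k) = ?X"
    using X0 k(2) by (cases "?X = 0") (simp_all add: powr_powr flip: powr_realpow)
  have prod: "(\<Prod>v\<in>e. C v * x v ^ k) = (\<Prod>v\<in>e. C v) * ?X ^ k"
    by (simp add: prod.distrib prod_power_distrib)
  have "(\<Prod>v\<in>e. C v * x v ^ k) powr (1 / card e) \<le> (\<Sum>v\<in>e. C v * x v ^ k / card e)"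
    using C x by (intro arith_geom_mean fin \<open>e \<noteq> {}\<close>) (simp add: less_imp_le)
  then have am_gm: "real k * (((\<Prod>v\<in>e. C v) * ?X ^ k) powr (1 / real k)) \<le> (\<Sum>v\<in>e. C v * x v ^ k)"
    using k by (simp add: prod pos_le_divide_eq mult.commute flip: sum_divide_distrib)
  {
    assume "1 \<le> (\<Prod>v\<in>e. C v)"
    then have "(1 * ?X ^ k) powr (1 / real k) \<le> ((\<Prod>v\<in>e. C v) * ?X ^ k) powr (1 / real k)"
      using X0 by (intro powr_mono2 mult_right_mono) auto
    then have "?X \<le> ((\<Prod>v\<in>e. C v) * ?X ^ k) powr (1 / real k)" by (simp add: root)
    with am_gm show "real k * ?X \<le> (\<Sum>v\<in>e. C v * x v ^ k)"
      using mult_left_mono [of ?X _ "real k"] by (meson of_nat_0_le_iff order_trans)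
  }
  {
    assume "1 < (\<Prod>v\<in>e. C v)" and "\<And>v. v \<in> e \<Longrightarrow> 0 < x v"
    then have "0 < ?X" by (intro prod_pos) auto
    with \<open>1 < (\<Prod>v\<in>e. C v)\<close>
    have "(1 * ?X ^ k) powr (1 / real k) < ((\<Prod>v\<in>e. C v) * ?X ^ k) powr (1 / real k)"
      using k by (intro powr_less_mono2 mult_strict_right_mono) auto
    then have "real k * ?X < real k * (((\<Prod>v\<in>e. C v) * ?X ^ k) powr (1 / real k))"
      using k by (simp add: root)
    with am_gm show "real k * ?X < (\<Sum>v\<in>e. C v * x v ^ k)" by linarith
  }
qed

text \<open>If \<open>x\<close> has both zero and positive entries, no condition on the product of the \<open>C v\<close> is needed.\<close>
lemma weighted_arith_geom_mean_mixed:
  fixes C x :: "'a \<Rightarrow> real"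
  assumes "finite e" and "\<And>v. v \<in> e \<Longrightarrow> 0 < C v" and "\<And>v. v \<in> e \<Longrightarrow> 0 \<le> x v"
    and "u \<in> e" "x u = 0" and w: "w \<in> e" "0 < x w"
  shows "real k * (\<Prod>v\<in>e. x v) < (\<Sum>v\<in>e. C v * x v ^ k)"
proof -
  have "(\<Prod>v\<in>e. x v) = 0" using assms(1,4,5) by (intro prod_zero) auto
  moreover have "0 < (\<Sum>v\<in>e. C v * x v ^ k)"
  proof (rule sum_pos2 [OF assms(1) w(1)])
    show "0 < C w * x w ^ k" using assms(2) [OF w(1)] w(2) by simp
    show "0 \<le> C v * x v ^ k" if "v \<in> e" for v
      using assms(2,3) [OF that] by simp
  qed
  ultimately show ?thesis by simp
qed

lemma convex_on_power_nonneg: "convex_on {0::real..} (\<lambda>x. x ^ k)"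
proof (cases "even k")
  case True
  then show ?thesis
    using convex_on_subset [OF convex_power_even [OF True]] by simp
next
  case False
  then show ?thesis by (rule convex_power_odd)
qed

text \<open>
  Jensen's inequality for \<open>t\<^bsup>p+1\<^esup>\<close> with weights proportional to \<open>u\<close>; this is a form of
  Hoelder's inequality.
\<close>
lemma power_sum_le_weighted:
  fixes u x :: "'a \<Rightarrow> real"
  assumes fin: "finite Z" "Z \<noteq> {}" and u: "\<And>v. v \<in> Z \<Longrightarrow> 0 < u v" and x: "\<And>v. v \<in> Z \<Longrightarrow> 0 \<le> x v"
  shows "(\<Sum>v\<in>Z. x v) ^ Suc p \<le> (\<Sum>v\<in>Z. u v) ^ p * (\<Sum>v\<in>Z. x v ^ Suc p / u v ^ p)"
proof -
  define U where "U = (\<Sum>v\<in>Z. u v)"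
  have U: "0 < U" unfolding U_def using fin u by (intro sum_pos)
  have "(\<lambda>x. x ^ Suc p) (\<Sum>v\<in>Z. (u v / U) *\<^sub>R (x v * U / u v))
      \<le> (\<Sum>v\<in>Z. (u v / U) * (\<lambda>x. x ^ Suc p) (x v * U / u v))"
  proof (rule convex_on_sum [OF fin convex_on_power_nonneg])
    show "(\<Sum>v\<in>Z. u v / U) = 1" using U by (simp add: U_def flip: sum_divide_distrib)
    show "0 \<le> u v / U" if "v \<in> Z" for v using u [OF that] U by simp
    show "x v * U / u v \<in> {0..}" if "v \<in> Z" for v using u [OF that] x [OF that] U by simp
  qed
  also have "(\<Sum>v\<in>Z. (u v / U) *\<^sub>R (x v * U / u v)) = (\<Sum>v\<in>Z. x v)"
    using u U by (intro sum.cong refl) (auto simp: less_imp_neq [symmetric])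
  also have "(\<Sum>v\<in>Z. (u v / U) * (x v * U / u v) ^ Suc p) = U ^ p * (\<Sum>v\<in>Z. x v ^ Suc p / u v ^ p)"
    unfolding sum_distrib_left
  proof (intro sum.cong refl)
    fix v assume "v \<in> Z"
    then have "u v \<noteq> 0" "U \<noteq> 0" using u [of v] U by auto
    then show "(u v / U) * (x v * U / u v) ^ Suc p = U ^ p * (x v ^ Suc p / u v ^ p)"
      by (simp add: power_mult_distrib power_divide field_simps)
  qed
  finally show ?thesis by (simp add: U_def)
qed

text \<open>
  The weights \<open>b v = B v e\<close> at a fixed edge \<open>e\<close> of a supertree with \<open>m\<close> edges.
\<close>
locale edge_weights =
  fixes e :: "'a set" and k :: nat and m :: real and b :: "'a \<Rightarrow> real"
  assumes fin: "finite e" and card_e: "card e = k" and k: "k \<ge> 2" and m: "m \<ge> 1"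
    and b: "\<And>v. v \<in> e \<Longrightarrow> 0 < b v" "\<And>v. v \<in> e \<Longrightarrow> b v \<le> 1"
    and sum_b: "(\<Sum>v\<in>e. 1 - b v) = 1 - 1 / m"
begin

text \<open>
  The Weierstrass inequality for \<open>t\<^sub>v = \<tau> (1 - b v)\<close>.  The factor \<open>\<tau>\<close> is \<open>1\<close> except for the signless
  Laplacian.
\<close>
lemma prod_scaled_ge:
  fixes \<tau> :: real
  assumes \<tau>: "0 < \<tau>" "\<tau> * (1 - 1 / m) < 1"
  shows "1 - \<tau> * (1 - 1 / m) \<le> (\<Prod>v\<in>e. 1 - \<tau> * (1 - b v))"
    and "u \<in> e \<Longrightarrow> w \<in> e \<Longrightarrow> u \<noteq> w \<Longrightarrow> b u < 1 \<Longrightarrow> b w < 1 \<Longrightarrow>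
           1 - \<tau> * (1 - 1 / m) < (\<Prod>v\<in>e. 1 - \<tau> * (1 - b v))"
    and "v \<in> e \<Longrightarrow> 0 < 1 - \<tau> * (1 - b v)"
proof -
  have sum: "(\<Sum>v\<in>e. \<tau> * (1 - b v)) = \<tau> * (1 - 1 / m)"
    using sum_b by (simp flip: sum_distrib_left)
  have nonneg: "0 \<le> \<tau> * (1 - b v)" if "v \<in> e" for v
    using \<tau> b(2) [OF that] by simp
  have lt1: "\<tau> * (1 - b v) < 1" if "v \<in> e" for v
    using member_le_sum [OF that, of "\<lambda>v. \<tau> * (1 - b v)"] nonneg fin \<tau>(2) sum by fastforce
  show "v \<in> e \<Longrightarrow> 0 < 1 - \<tau> * (1 - b v)" using lt1 [of v] by simp
  show "1 - \<tau> * (1 - 1 / m) \<le> (\<Prod>v\<in>e. 1 - \<tau> * (1 - b v))"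
    unfolding sum [symmetric] using nonneg lt1 by (intro Weierstrass_prod_ineq) (auto simp: less_imp_le)
  show "1 - \<tau> * (1 - 1 / m) < (\<Prod>v\<in>e. 1 - \<tau> * (1 - b v))"
    if "u \<in> e" "w \<in> e" "u \<noteq> w" "b u < 1" "b w < 1"
    unfolding sum [symmetric]
    using that \<tau> sum nonneg by (intro Weierstrass_prod_ineq_strict [of e _ u w] fin) auto
qed

lemma prod_weights_ge:
  "1 / m \<le> (\<Prod>v\<in>e. b v)"
  "u \<in> e \<Longrightarrow> w \<in> e \<Longrightarrow> u \<noteq> w \<Longrightarrow> b u < 1 \<Longrightarrow> b w < 1 \<Longrightarrow> 1 / m < (\<Prod>v\<in>e. b v)"
  using prod_scaled_ge [of 1] m by simp_all

text \<open>
  In each of the following three lemmas the first statement is the bound, and the other two are the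
  strict bounds needed in \<open>spectral_radius_le_weighted\<close>.
\<close>
lemma adjacency_edge_bound:
  assumes \<mu>: "0 < \<mu>" "\<mu> ^ k = m" and x: "\<And>v. v \<in> e \<Longrightarrow> 0 \<le> x v"
  shows "real k * (\<Prod>v\<in>e. x v) \<le> \<mu> * (\<Sum>v\<in>e. b v * x v ^ k)"
    and "u \<in> e \<Longrightarrow> x u = 0 \<Longrightarrow> w \<in> e \<Longrightarrow> 0 < x w \<Longrightarrow>
           real k * (\<Prod>v\<in>e. x v) < \<mu> * (\<Sum>v\<in>e. b v * x v ^ k)"
    and "(\<And>v. v \<in> e \<Longrightarrow> 0 < x v) \<Longrightarrow> u \<in> e \<Longrightarrow> w \<in> e \<Longrightarrow> u \<noteq> w \<Longrightarrow> b u < 1 \<Longrightarrow> b w < 1 \<Longrightarrow>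
           real k * (\<Prod>v\<in>e. x v) < \<mu> * (\<Sum>v\<in>e. b v * x v ^ k)"
proof -
  define C where "C = (\<lambda>v. \<mu> * b v)"
  have C: "0 < C v" if "v \<in> e" for v using \<mu>(1) b(1) [OF that] by (simp add: C_def)
  have sum: "\<mu> * (\<Sum>v\<in>e. b v * x v ^ k) = (\<Sum>v\<in>e. C v * x v ^ k)"
    by (simp add: C_def sum_distrib_left mult_ac)
  have prod: "(\<Prod>v\<in>e. C v) = m * (\<Prod>v\<in>e. b v)"
    by (simp add: C_def prod.distrib card_e \<mu>(2))
  have "k \<ge> 1" using k by simp
  show "real k * (\<Prod>v\<in>e. x v) \<le> \<mu> * (\<Sum>v\<in>e. b v * x v ^ k)"
    unfolding sum using prod_weights_ge(1) m
    by (intro weighted_arith_geom_mean(1) fin card_e \<open>k \<ge> 1\<close> C x) (simp_all add: prod field_simps)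
  show "real k * (\<Prod>v\<in>e. x v) < \<mu> * (\<Sum>v\<in>e. b v * x v ^ k)"
    if "u \<in> e" "x u = 0" "w \<in> e" "0 < x w"
    unfolding sum using that by (intro weighted_arith_geom_mean_mixed [OF fin C x]) auto
  show "real k * (\<Prod>v\<in>e. x v) < \<mu> * (\<Sum>v\<in>e. b v * x v ^ k)"
    if "\<And>v. v \<in> e \<Longrightarrow> 0 < x v" "u \<in> e" "w \<in> e" "u \<noteq> w" "b u < 1" "b w < 1"
    unfolding sum using prod_weights_ge(2) [OF that(2-6)] m that(1)
    by (intro weighted_arith_geom_mean(2) fin card_e \<open>k \<ge> 1\<close> C x) (simp_all add: prod field_simps)
qed

lemma signless_laplacian_edge_bound:
  assumes \<alpha>: "0 < \<alpha>" "\<alpha> ^ k - (m - 1) * \<alpha> ^ (k - 1) = m" and x: "\<And>v. v \<in> e \<Longrightarrow> 0 \<le> x v"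
  shows "(\<Sum>v\<in>e. x v ^ k) + real k * (\<Prod>v\<in>e. x v) \<le> (1 + \<alpha>) * (\<Sum>v\<in>e. b v * x v ^ k)"
    and "u \<in> e \<Longrightarrow> x u = 0 \<Longrightarrow> w \<in> e \<Longrightarrow> 0 < x w \<Longrightarrow>
           (\<Sum>v\<in>e. x v ^ k) + real k * (\<Prod>v\<in>e. x v) < (1 + \<alpha>) * (\<Sum>v\<in>e. b v * x v ^ k)"
    and "(\<And>v. v \<in> e \<Longrightarrow> 0 < x v) \<Longrightarrow> u \<in> e \<Longrightarrow> w \<in> e \<Longrightarrow> u \<noteq> w \<Longrightarrow> b u < 1 \<Longrightarrow> b w < 1 \<Longrightarrow>
           (\<Sum>v\<in>e. x v ^ k) + real k * (\<Prod>v\<in>e. x v) < (1 + \<alpha>) * (\<Sum>v\<in>e. b v * x v ^ k)"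
proof -
  \<comment> \<open>Subtracting \<open>\<Sum>\<^bsub>v\<in>e\<^esub> x\<^sub>v\<^sup>k\<close> from both sides leaves the coefficients \<open>(1 + \<alpha>) b v - 1\<close>; \<open>\<tau>\<close> is
    chosen so that they become \<open>\<alpha>\<close> times the factors of the Weierstrass inequality.\<close>
  define \<tau> where "\<tau> = (1 + \<alpha>) / \<alpha>"
  define C where "C = (\<lambda>v. \<alpha> * (1 - \<tau> * (1 - b v)))"
  have C_eq: "C v = (1 + \<alpha>) * b v - 1" for v
    using \<alpha>(1) by (simp add: C_def \<tau>_def field_simps)
  \<comment> \<open>The equation for \<open>\<alpha>\<close> says precisely that the Weierstrass bound for \<open>\<Prod> C\<close> is \<open>1\<close>.\<close>
  have key: "\<alpha> ^ k * (1 - \<tau> * (1 - 1 / m)) = 1"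
  proof -
    obtain p where p: "k = Suc p" using k by (cases k) auto
    have "m * (\<alpha> ^ k * (1 - \<tau> * (1 - 1 / m))) = \<alpha> ^ k - (m - 1) * \<alpha> ^ (k - 1)"
      using \<alpha>(1) m by (simp add: p \<tau>_def field_simps)
    with \<alpha>(2) m show ?thesis by simp
  qed
  then have \<tau>: "0 < \<tau>" "\<tau> * (1 - 1 / m) < 1"
  proof -
    show "0 < \<tau>" using \<alpha>(1) by (simp add: \<tau>_def)
    have "0 < \<alpha> ^ k * (1 - \<tau> * (1 - 1 / m))" using key by simp
    then show "\<tau> * (1 - 1 / m) < 1" using \<alpha>(1) by (simp add: zero_less_mult_iff)
  qed
  note ge = prod_scaled_ge [OF \<tau>]
  have C: "0 < C v" if "v \<in> e" for v using ge(3) [OF that] \<alpha>(1) by (simp add: C_def)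
  have sum: "(1 + \<alpha>) * (\<Sum>v\<in>e. b v * x v ^ k) = (\<Sum>v\<in>e. x v ^ k) + (\<Sum>v\<in>e. C v * x v ^ k)"
  proof -
    have "C v * x v ^ k = (1 + \<alpha>) * (b v * x v ^ k) - x v ^ k" for v
      by (simp add: C_eq algebra_simps)
    then show ?thesis by (simp add: sum_subtractf sum_distrib_left)
  qed
  have prod: "(\<Prod>v\<in>e. C v) = \<alpha> ^ k * (\<Prod>v\<in>e. 1 - \<tau> * (1 - b v))"
    by (simp add: C_def prod.distrib card_e)
  have "k \<ge> 1" using k by simp
  have prod_ge: "1 \<le> (\<Prod>v\<in>e. C v)"
  proof -
    have "\<alpha> ^ k * (1 - \<tau> * (1 - 1 / m)) \<le> \<alpha> ^ k * (\<Prod>v\<in>e. 1 - \<tau> * (1 - b v))"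
      using ge(1) \<alpha>(1) by (intro mult_left_mono) auto
    then show ?thesis by (simp only: key prod)
  qed
  show "(\<Sum>v\<in>e. x v ^ k) + real k * (\<Prod>v\<in>e. x v) \<le> (1 + \<alpha>) * (\<Sum>v\<in>e. b v * x v ^ k)"
    unfolding sum
    by (intro add_left_mono weighted_arith_geom_mean(1) fin card_e \<open>k \<ge> 1\<close> C x prod_ge)
  show "(\<Sum>v\<in>e. x v ^ k) + real k * (\<Prod>v\<in>e. x v) < (1 + \<alpha>) * (\<Sum>v\<in>e. b v * x v ^ k)"
    if "u \<in> e" "x u = 0" "w \<in> e" "0 < x w"
    unfolding sum using that
    by (intro add_strict_left_mono weighted_arith_geom_mean_mixed [OF fin C x]) auto
  show "(\<Sum>v\<in>e. x v ^ k) + real k * (\<Prod>v\<in>e. x v) < (1 + \<alpha>) * (\<Sum>v\<in>e. b v * x v ^ k)"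
    if "\<And>v. v \<in> e \<Longrightarrow> 0 < x v" "u \<in> e" "w \<in> e" "u \<noteq> w" "b u < 1" "b w < 1"
  proof -
    have "\<alpha> ^ k * (1 - \<tau> * (1 - 1 / m)) < \<alpha> ^ k * (\<Prod>v\<in>e. 1 - \<tau> * (1 - b v))"
      using ge(2) [OF that(2-6)] \<alpha>(1) by (intro mult_strict_left_mono) auto
    then have "1 < (\<Prod>v\<in>e. C v)" by (simp only: key prod)
    then show ?thesis
      unfolding sum using that(1)
      by (intro add_strict_left_mono weighted_arith_geom_mean(2) fin card_e \<open>k \<ge> 1\<close> C x)
  qed
qed

text \<open>
  Jensen's inequality is applied with \<open>r v = (b v)\<^bsup>-1/(k-1)\<^esup>\<close>.  The sum of the \<open>r v\<close> is largest when
  all but one of them are \<open>1\<close>, because \<open>1 + \<Sum>(r v - 1) \<le> \<Prod> r v \<le> c\<close>.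
\<close>
lemma incidence_Q_edge_bound:
  assumes c: "0 < c" "c ^ (k - 1) = m" and x: "\<And>v. v \<in> e \<Longrightarrow> 0 \<le> x v"
  shows "(\<Sum>v\<in>e. x v) ^ k \<le> (c + real k - 1) ^ (k - 1) * (\<Sum>v\<in>e. b v * x v ^ k)"
    and "u \<in> e \<Longrightarrow> x u = 0 \<Longrightarrow> w \<in> e \<Longrightarrow> 0 < x w \<Longrightarrow>
           (\<Sum>v\<in>e. x v) ^ k < (c + real k - 1) ^ (k - 1) * (\<Sum>v\<in>e. b v * x v ^ k)"
    and "(\<And>v. v \<in> e \<Longrightarrow> 0 < x v) \<Longrightarrow> u \<in> e \<Longrightarrow> w \<in> e \<Longrightarrow> u \<noteq> w \<Longrightarrow> b u < 1 \<Longrightarrow> b w < 1 \<Longrightarrow>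
           (\<Sum>v\<in>e. x v) ^ k < (c + real k - 1) ^ (k - 1) * (\<Sum>v\<in>e. b v * x v ^ k)"
proof -
  obtain p where p: "k = Suc p" "p \<noteq> 0" using k by (cases k) auto
  define r where "r = (\<lambda>v. root p (1 / b v))"
  define R where "R = (\<Sum>v\<in>e. r v)"
  have r_pow: "r v ^ p = 1 / b v" and r_ge: "1 \<le> r v" if "v \<in> e" for v
    using b [OF that] p(2) by (simp_all add: r_def)
  have r_pos: "0 < r v" if "v \<in> e" for v using r_ge [OF that] by simp
  have prod_r: "(\<Prod>v\<in>e. r v) ^ p = 1 / (\<Prod>v\<in>e. b v)"
    using r_pow by (simp add: prod_power_distrib prod_dividef)
  have prod_r_pos: "0 < (\<Prod>v\<in>e. r v)" by (intro prod_pos) (use r_pos in auto)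
  have prod_b_pos: "0 < (\<Prod>v\<in>e. b v)" by (intro prod_pos) (use b in auto)
  have "1 + (\<Sum>v\<in>e. r v - 1) \<le> (\<Prod>v\<in>e. 1 + (r v - 1))"
    using r_ge by (intro one_plus_sum_le_prod fin) simp
  then have R_prod: "R \<le> (\<Prod>v\<in>e. r v) + real k - 1"
    by (simp add: R_def sum_subtractf card_e)
  have "(\<Prod>v\<in>e. r v) ^ p \<le> c ^ p"
    using prod_weights_ge(1) m c(2) prod_b_pos by (simp add: prod_r p(1) field_simps)
  then have "(\<Prod>v\<in>e. r v) \<le> c"
    using prod_r_pos c(1) p(2) by (simp add: power_mono_iff)
  with R_prod have R_le: "R \<le> c + real k - 1" by simp
  have R0: "0 \<le> R" unfolding R_def by (intro sum_nonneg less_imp_le r_pos)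
  define S where "S = (\<Sum>v\<in>e. b v * x v ^ k)"
  have S0: "0 \<le> S" unfolding S_def using b x by (intro sum_nonneg) (simp add: less_imp_le)
  have "e \<noteq> {}" using card_e k by auto
  have weights: "(\<Sum>v\<in>Z. x v ^ Suc p / r v ^ p) = (\<Sum>v\<in>Z. b v * x v ^ k)" if "Z \<subseteq> e" for Z
  proof (intro sum.cong refl)
    fix v assume "v \<in> Z"
    with that have "v \<in> e" by blast
    then show "x v ^ Suc p / r v ^ p = b v * x v ^ k"
      by (simp only: r_pow p(1)) simp
  qed
  have jensen: "(\<Sum>v\<in>Z. x v) ^ k \<le> (\<Sum>v\<in>Z. r v) ^ p * (\<Sum>v\<in>Z. b v * x v ^ k)"
    if "Z \<subseteq> e" "Z \<noteq> {}" for Z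
  proof -
    have "(\<Sum>v\<in>Z. x v) ^ Suc p \<le> (\<Sum>v\<in>Z. r v) ^ p * (\<Sum>v\<in>Z. x v ^ Suc p / r v ^ p)"
      using that r_pos x finite_subset [OF that(1) fin] by (intro power_sum_le_weighted) auto
    then show ?thesis unfolding weights [OF that(1)] p(1) .
  qed
  have le: "(\<Sum>v\<in>e. x v) ^ k \<le> R ^ p * S"
    using jensen [of e] \<open>e \<noteq> {}\<close> by (simp add: R_def S_def)
  have R_pow: "R ^ p * S \<le> (c + real k - 1) ^ p * S"
    using R_le R0 S0 by (intro mult_right_mono power_mono)
  have kp: "k - 1 = p" using p by simp
  show "(\<Sum>v\<in>e. x v) ^ k \<le> (c + real k - 1) ^ (k - 1) * (\<Sum>v\<in>e. b v * x v ^ k)"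
    using le R_pow unfolding kp S_def by (rule order_trans)
  have S_pos: "0 < S" if w: "w \<in> e" "0 < x w" for w
    unfolding S_def using b x w by (intro sum_pos2 [OF fin w(1)]) (auto simp: less_imp_le)
  show "(\<Sum>v\<in>e. x v) ^ k < (c + real k - 1) ^ (k - 1) * (\<Sum>v\<in>e. b v * x v ^ k)"
    if u: "u \<in> e" "x u = 0" and w: "w \<in> e" "0 < x w"
  proof -
    have "(\<Sum>v\<in>e. x v) ^ k = (\<Sum>v\<in>e - {u}. x v) ^ k"
      using u by (simp add: sum.remove [OF fin u(1)])
    also have "\<dots> \<le> (\<Sum>v\<in>e - {u}. r v) ^ p * (\<Sum>v\<in>e - {u}. b v * x v ^ k)"
      using u w by (intro jensen) auto
    also have "(\<Sum>v\<in>e - {u}. b v * x v ^ k) = S"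
      using u p by (simp add: S_def sum.remove [OF fin u(1)])
    also have "(\<Sum>v\<in>e - {u}. r v) ^ p * S < R ^ p * S"
    proof (intro mult_strict_right_mono power_strict_mono S_pos [OF w])
      show "(\<Sum>v\<in>e - {u}. r v) < R"
        using r_pos [OF u(1)] by (simp add: R_def sum.remove [OF fin u(1)])
      show "0 \<le> (\<Sum>v\<in>e - {u}. r v)"
        using r_pos by (intro sum_nonneg) (simp add: less_imp_le)
      show "0 < p" using p by simp
    qed
    finally show ?thesis using R_pow unfolding kp S_def by (rule less_le_trans)
  qed
  show "(\<Sum>v\<in>e. x v) ^ k < (c + real k - 1) ^ (k - 1) * (\<Sum>v\<in>e. b v * x v ^ k)"
    if pos: "\<And>v. v \<in> e \<Longrightarrow> 0 < x v" and uw: "u \<in> e" "w \<in> e" "u \<noteq> w" "b u < 1" "b w < 1"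
  proof -
    have "(\<Prod>v\<in>e. r v) ^ p < c ^ p"
      using prod_weights_ge(2) [OF uw] m c(2) prod_b_pos by (simp add: prod_r p(1) field_simps)
    then have "(\<Prod>v\<in>e. r v) < c"
      by (rule power_less_imp_less_base) (use c(1) in simp)
    with R_prod have "R < c + real k - 1" by simp
    then have "R ^ p * S < (c + real k - 1) ^ p * S"
      using R0 p(2) S_pos [OF uw(1) pos [OF uw(1)]]
      by (intro mult_strict_right_mono power_strict_mono) auto
    with le show ?thesis unfolding kp S_def by (rule le_less_trans)
  qed
qed

end

text \<open>
  The polynomial is \<open>x\<^bsup>k-1\<^esup> (x - (m-1)) - m\<close>, which changes sign on \<open>[m-1, m]\<close> and is strictly
  increasing beyond \<open>m - 1\<close>.
\<close>
lemma signless_laplacian_root: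
  assumes "k \<ge> 2" and "m \<ge> (1::real)"
  obtains \<alpha> where "\<alpha> ^ k - (m - 1) * \<alpha> ^ (k - 1) - m = 0"
    and "\<And>x. x ^ k - (m - 1) * x ^ (k - 1) - m = 0 \<Longrightarrow> x \<le> \<alpha>"
    and "m - 1 < \<alpha>" and "\<alpha> \<le> m"
proof -
  obtain p where p: "k = Suc p" "p \<ge> 1" using assms(1) by (cases k) auto
  define f where "f = (\<lambda>x::real. x ^ p * (x - (m - 1)) - m)"
  have f: "x ^ k - (m - 1) * x ^ (k - 1) - m = f x" for x
    by (simp add: f_def p(1) algebra_simps)
  have "f (m - 1) \<le> 0" using assms(2) by (simp add: f_def)
  moreover have "0 \<le> f m"
    using assms(2) p(2) self_le_power [of m p] by (simp add: f_def)
  moreover have "continuous_on {m - 1..m} f"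
    unfolding f_def by (intro continuous_intros)
  ultimately obtain \<alpha> where \<alpha>: "m - 1 \<le> \<alpha>" "\<alpha> \<le> m" "f \<alpha> = 0"
    using IVT' [of f "m - 1" 0 m] by auto
  have "\<alpha> \<noteq> m - 1" using \<alpha>(3) assms(2) by (auto simp: f_def)
  with \<alpha>(1) have gt: "m - 1 < \<alpha>" by simp
  have largest: "x \<le> \<alpha>" if "f x = 0" for x
  proof (rule ccontr)
    assume "\<not> x \<le> \<alpha>"
    then have "\<alpha> < x" by simp
    then have "\<alpha> ^ p * (\<alpha> - (m - 1)) < x ^ p * (x - (m - 1))"
      using gt assms(2) by (intro mult_le_less_imp_less power_mono) auto
    with that \<alpha>(3) show False by (simp add: f_def)
  qed
  show thesis
  proof (rule that)
    show "\<alpha> ^ k - (m - 1) * \<alpha> ^ (k - 1) - m = 0" unfolding f by (rule \<alpha>(3))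
    show "x \<le> \<alpha>" if "x ^ k - (m - 1) * x ^ (k - 1) - m = 0" for x
      using that unfolding f by (rule largest)
  qed (rule gt \<alpha>(2))+
qed

section \<open>The three bounds\<close>

text \<open>
  In a hyperstar the bounds are attained at a vector with some entry \<open>s\<close> at the centre \<open>c\<close> and \<open>1\<close> at
  all other vertices: \<open>s = m\<^bsup>1/k\<^esup>\<close>, \<open>s = \<alpha>\<close> and \<open>s = m\<^bsup>1/(k-1)\<^esup>\<close>, respectively.  The following two
  lemmas evaluate sums and products of such vectors.
\<close>

lemma sum_centre:
  fixes g :: "real \<Rightarrow> real"
  assumes "finite S" "c \<in> S"
  shows "(\<Sum>v\<in>S. g (if v = c then s else 1)) = g s + (real (card S) - 1) * g 1"
proof -
  have "(\<Sum>v\<in>S - {c}. g (if v = c then s else 1)) = (\<Sum>v\<in>S - {c}. g 1)"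
    by (intro sum.cong refl) auto
  moreover have "real (card (S - {c})) = real (card S) - 1"
  proof -
    have "card S \<ge> 1" using assms by (auto simp: Suc_le_eq card_gt_0_iff)
    then show ?thesis using assms(2) by (simp add: card_Diff_singleton of_nat_diff)
  qed
  ultimately show ?thesis
    using assms by (simp add: sum.remove [of S c])
qed

lemma prod_centre:
  fixes s :: real
  assumes "finite S" "c \<in> S"
  shows "(\<Prod>v\<in>S. if v = c then s else 1) = s"
  using assms by (simp add: prod.delta)

lemma supertree_edge_weights:
  assumes T: "supertree n k E" and k: "k \<ge> 2"
  obtains B :: "nat \<Rightarrow> nat set \<Rightarrow> real" where
    "\<And>e. e \<in> E \<Longrightarrow> edge_weights e k (real (card E)) (\<lambda>v. B v e)"
    and "\<And>v. v \<in> {1..n} \<Longrightarrow> (\<Sum>e | e \<in> E \<and> v \<in> e. B v e) \<le> 1"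
    and "\<And>e v. e \<in> E \<Longrightarrow> v \<in> e \<Longrightarrow> branching E v \<Longrightarrow> B v e < 1"
proof -
  note T' = supertreeD [OF T]
  have "k \<ge> 1" using k by simp
  obtain B :: "nat \<Rightarrow> nat set \<Rightarrow> real" where
    B: "\<And>e v. e \<in> E \<Longrightarrow> v \<in> e \<Longrightarrow> 0 < B v e \<and> B v e \<le> 1"
    "\<And>v. v \<in> {1..n} \<Longrightarrow> (\<Sum>e | e \<in> E \<and> v \<in> e. B v e) \<le> 1"
    "\<And>e. e \<in> E \<Longrightarrow> (\<Sum>v\<in>e. 1 - B v e) = 1 - 1 / real (card E)"
    "\<And>e v. e \<in> E \<Longrightarrow> v \<in> e \<Longrightarrow> branching E v \<Longrightarrow> B v e < 1"
    using supertree_weights [OF T \<open>k \<ge> 1\<close>] by blast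
  have weights: "edge_weights e k (real (card E)) (\<lambda>v. B v e)" if e: "e \<in> E" for e
  proof
    show "finite e" "card e = k" "2 \<le> k" using T'(4,5) [OF e] k by simp_all
    have "card E \<ge> 1" using e T'(6) by (auto simp: Suc_le_eq card_gt_0_iff)
    then show "1 \<le> real (card E)" by simp
    show "0 < B v e" "B v e \<le> 1" if "v \<in> e" for v using B(1) [OF e that] by simp_all
    show "(\<Sum>v\<in>e. 1 - B v e) = 1 - 1 / real (card E)" by (rule B(3) [OF e])
  qed
  show thesis by (rule that [OF weights B(2,4)])
qed

text \<open>
  In the three bounds, equality is characterised by a vertex common to all edges; for supertrees this
  is equivalent to being a hyperstar by \<open>isomorphic_hyperstar_iff\<close>.
\<close>
theorem adjacency_spectral_radius_bound:
  assumes k: "k \<ge> 2" and T: "supertree n k E" and m: "card E = m" "m \<ge> 1"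
    and \<mu>: "0 < \<mu>" "\<mu> ^ k = real m"
  shows "spectral_radius k n (adjacency_tensor k E) \<le> \<mu> \<and>
    (spectral_radius k n (adjacency_tensor k E) = \<mu> \<longleftrightarrow> (\<exists>c\<in>{1..n}. \<forall>e\<in>E. c \<in> e))"
proof -
  note T' = supertreeD [OF T]
  obtain B :: "nat \<Rightarrow> nat set \<Rightarrow> real" where
    W: "\<And>e. e \<in> E \<Longrightarrow> edge_weights e k (real m) (\<lambda>v. B v e)"
    and B: "\<And>v. v \<in> {1..n} \<Longrightarrow> (\<Sum>e | e \<in> E \<and> v \<in> e. B v e) \<le> 1"
    and B1: "\<And>e v. e \<in> E \<Longrightarrow> v \<in> e \<Longrightarrow> branching E v \<Longrightarrow> B v e < 1"
    using supertree_edge_weights [OF T k] m(1) by blast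
  show ?thesis
  proof (rule spectral_radius_le_weighted [OF k T _ symmetric_adjacency _ _ _ B B1])
    show "E \<noteq> {}" using m by auto
    show "0 \<le> adjacency_tensor k E js" for js by (simp add: adjacency_tensor_def)
    show "tensor_form k n (adjacency_tensor k E) x = (\<Sum>e\<in>E. real k * (\<Prod>v\<in>e. x v))" for x
      using k by (intro tensor_form_adjacency T'(3,4,6)) auto
    show "0 \<le> \<mu>" using \<mu> by simp
  next
    fix e and x :: "nat \<Rightarrow> real"
    assume "e \<in> E" "\<And>v. 0 \<le> x v"
    then show "real k * (\<Prod>v\<in>e. x v) \<le> \<mu> * (\<Sum>v\<in>e. B v e * x v ^ k)"
      by (intro edge_weights.adjacency_edge_bound(1) [OF W \<mu>])
  next
    fix e u w and x :: "nat \<Rightarrow> real"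
    assume "e \<in> E" "\<And>v. 0 \<le> x v" "u \<in> e" "x u = 0" "w \<in> e" "0 < x w"
    then show "real k * (\<Prod>v\<in>e. x v) < \<mu> * (\<Sum>v\<in>e. B v e * x v ^ k)"
      by (intro edge_weights.adjacency_edge_bound(2) [OF W \<mu>])
  next
    fix e u w and x :: "nat \<Rightarrow> real"
    assume "e \<in> E" and x: "\<And>v. v \<in> e \<Longrightarrow> 0 < x v"
      and "u \<in> e" "w \<in> e" "u \<noteq> w" "B u e < 1" "B w e < 1"
    then show "real k * (\<Prod>v\<in>e. x v) < \<mu> * (\<Sum>v\<in>e. B v e * x v ^ k)"
      by (intro edge_weights.adjacency_edge_bound(3) [OF W \<mu> less_imp_le [OF x]])
  next
    fix c assume c: "c \<in> {1..n}" "\<forall>e\<in>E. c \<in> e" and n: "n = card E * (k - 1) + 1"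
    let ?y = "\<lambda>v. if v = c then \<mu> else 1"
    have "(\<Sum>v\<in>{1..n}. ?y v ^ k) = real m * real k"
      using sum_centre [of "{1..n}" c "\<lambda>t. t ^ k" \<mu>] c(1) k
      by (simp add: \<mu>(2) n m(1) of_nat_diff algebra_simps)
    moreover have "(\<Sum>e\<in>E. real k * (\<Prod>v\<in>e. ?y v)) = real m * (real k * \<mu>)"
      using c(2) T'(5) by (simp add: prod_centre m(1))
    ultimately have "(\<Sum>e\<in>E. real k * (\<Prod>v\<in>e. ?y v)) = \<mu> * (\<Sum>v\<in>{1..n}. ?y v ^ k)"
      by simp
    then show "\<exists>y. (\<forall>v. 0 < y v) \<and>
        (\<Sum>e\<in>E. real k * (\<Prod>v\<in>e. y v)) = \<mu> * (\<Sum>v\<in>{1..n}. y v ^ k)"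
      using \<mu>(1) by (intro exI [of _ ?y]) simp
  qed
qed

theorem signless_laplacian_spectral_radius_bound:
  assumes k: "k \<ge> 2" and T: "supertree n k E" and m: "card E = m" "m \<ge> 1"
    and \<alpha>: "0 < \<alpha>" "\<alpha> ^ k - (real m - 1) * \<alpha> ^ (k - 1) = real m"
  shows "spectral_radius k n (signless_laplacian_tensor k E) \<le> 1 + \<alpha> \<and>
    (spectral_radius k n (signless_laplacian_tensor k E) = 1 + \<alpha>
      \<longleftrightarrow> (\<exists>c\<in>{1..n}. \<forall>e\<in>E. c \<in> e))"
proof -
  note T' = supertreeD [OF T]
  obtain B :: "nat \<Rightarrow> nat set \<Rightarrow> real" where
    W: "\<And>e. e \<in> E \<Longrightarrow> edge_weights e k (real m) (\<lambda>v. B v e)"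
    and B: "\<And>v. v \<in> {1..n} \<Longrightarrow> (\<Sum>e | e \<in> E \<and> v \<in> e. B v e) \<le> 1"
    and B1: "\<And>e v. e \<in> E \<Longrightarrow> v \<in> e \<Longrightarrow> branching E v \<Longrightarrow> B v e < 1"
    using supertree_edge_weights [OF T k] m(1) by blast
  show ?thesis
  proof (rule spectral_radius_le_weighted [OF k T _ symmetric_signless_laplacian _ _ _ B B1])
    show "E \<noteq> {}" using m by auto
    show "0 \<le> signless_laplacian_tensor k E js" for js
      by (simp add: signless_laplacian_tensor_def adjacency_tensor_def degree_tensor_def)
    show "tensor_form k n (signless_laplacian_tensor k E) x
        = (\<Sum>e\<in>E. (\<Sum>v\<in>e. x v ^ k) + real k * (\<Prod>v\<in>e. x v))" for x
      using k by (intro tensor_form_signless_laplacian T'(3,4,6)) auto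
    show "0 \<le> 1 + \<alpha>" using \<alpha> by simp
  next
    fix e and x :: "nat \<Rightarrow> real"
    assume "e \<in> E" "\<And>v. 0 \<le> x v"
    then show "(\<Sum>v\<in>e. x v ^ k) + real k * (\<Prod>v\<in>e. x v) \<le> (1 + \<alpha>) * (\<Sum>v\<in>e. B v e * x v ^ k)"
      by (intro edge_weights.signless_laplacian_edge_bound(1) [OF W \<alpha>])
  next
    fix e u w and x :: "nat \<Rightarrow> real"
    assume "e \<in> E" "\<And>v. 0 \<le> x v" "u \<in> e" "x u = 0" "w \<in> e" "0 < x w"
    then show "(\<Sum>v\<in>e. x v ^ k) + real k * (\<Prod>v\<in>e. x v) < (1 + \<alpha>) * (\<Sum>v\<in>e. B v e * x v ^ k)"
      by (intro edge_weights.signless_laplacian_edge_bound(2) [OF W \<alpha>])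
  next
    fix e u w and x :: "nat \<Rightarrow> real"
    assume "e \<in> E" and x: "\<And>v. v \<in> e \<Longrightarrow> 0 < x v"
      and "u \<in> e" "w \<in> e" "u \<noteq> w" "B u e < 1" "B w e < 1"
    then show "(\<Sum>v\<in>e. x v ^ k) + real k * (\<Prod>v\<in>e. x v) < (1 + \<alpha>) * (\<Sum>v\<in>e. B v e * x v ^ k)"
      by (intro edge_weights.signless_laplacian_edge_bound(3) [OF W \<alpha> less_imp_le [OF x]])
  next
    fix c assume c: "c \<in> {1..n}" "\<forall>e\<in>E. c \<in> e" and n: "n = card E * (k - 1) + 1"
    let ?y = "\<lambda>v. if v = c then \<alpha> else 1"
    obtain p where p: "k = Suc p" using k by (cases k) auto
    have root: "\<alpha> * \<alpha> ^ p = (real m - 1) * \<alpha> ^ p + real m" using \<alpha>(2) by (simp add: p)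
    have "(\<Sum>v\<in>{1..n}. ?y v ^ k) = \<alpha> ^ k + real m * (real k - 1)"
      using sum_centre [of "{1..n}" c "\<lambda>t. t ^ k" \<alpha>] c(1) k
      by (simp add: n m(1) of_nat_diff)
    moreover have "(\<Sum>e\<in>E. (\<Sum>v\<in>e. ?y v ^ k) + real k * (\<Prod>v\<in>e. ?y v))
        = real m * (\<alpha> ^ k + (real k - 1) + real k * \<alpha>)"
      using c(2) T'(4,5) sum_centre [of _ c "\<lambda>t. t ^ k" \<alpha>]
      by (simp add: prod_centre m(1))
    moreover have "real m * (\<alpha> ^ k + (real k - 1) + real k * \<alpha>)
        = (1 + \<alpha>) * (\<alpha> ^ k + real m * (real k - 1))"
    proof -
      have "real m * (\<alpha> ^ k + (real k - 1) + real k * \<alpha>)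
          - (1 + \<alpha>) * (\<alpha> ^ k + real m * (real k - 1))
          = \<alpha> * ((real m - 1) * \<alpha> ^ p + real m - \<alpha> * \<alpha> ^ p)"
        by (simp add: p algebra_simps)
      then show ?thesis by (simp add: root)
    qed
    ultimately have "(\<Sum>e\<in>E. (\<Sum>v\<in>e. ?y v ^ k) + real k * (\<Prod>v\<in>e. ?y v))
        = (1 + \<alpha>) * (\<Sum>v\<in>{1..n}. ?y v ^ k)"
      by (simp only:)
    then show "\<exists>y. (\<forall>v. 0 < y v) \<and> (\<Sum>e\<in>E. (\<Sum>v\<in>e. y v ^ k) + real k * (\<Prod>v\<in>e. y v))
        = (1 + \<alpha>) * (\<Sum>v\<in>{1..n}. y v ^ k)"
      using \<alpha>(1) by (intro exI [of _ ?y]) simp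
  qed
qed

theorem incidence_Q_spectral_radius_bound:
  assumes k: "k \<ge> 2" and T: "supertree n k E" and m: "card E = m" "m \<ge> 1"
    and s: "0 < s" "s ^ (k - 1) = real m"
  shows "spectral_radius k n (incidence_Q_tensor E) \<le> (s + real k - 1) ^ (k - 1) \<and>
    (spectral_radius k n (incidence_Q_tensor E) = (s + real k - 1) ^ (k - 1)
      \<longleftrightarrow> (\<exists>c\<in>{1..n}. \<forall>e\<in>E. c \<in> e))"
proof -
  note T' = supertreeD [OF T]
  obtain B :: "nat \<Rightarrow> nat set \<Rightarrow> real" where
    W: "\<And>e. e \<in> E \<Longrightarrow> edge_weights e k (real m) (\<lambda>v. B v e)"
    and B: "\<And>v. v \<in> {1..n} \<Longrightarrow> (\<Sum>e | e \<in> E \<and> v \<in> e. B v e) \<le> 1"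
    and B1: "\<And>e v. e \<in> E \<Longrightarrow> v \<in> e \<Longrightarrow> branching E v \<Longrightarrow> B v e < 1"
    using supertree_edge_weights [OF T k] m(1) by blast
  let ?\<mu> = "(s + real k - 1) ^ (k - 1)"
  show ?thesis
  proof (rule spectral_radius_le_weighted [OF k T _ symmetric_incidence_Q _ _ _ B B1])
    show "E \<noteq> {}" using m by auto
    show "0 \<le> incidence_Q_tensor E js" for js by (simp add: incidence_Q_tensor_def)
    show "tensor_form k n (incidence_Q_tensor E) x = (\<Sum>e\<in>E. (\<Sum>v\<in>e. x v) ^ k)" for x
      by (intro tensor_form_incidence_Q T'(3,6))
    show "0 \<le> ?\<mu>" using s k by simp
  next
    fix e and x :: "nat \<Rightarrow> real"
    assume "e \<in> E" "\<And>v. 0 \<le> x v"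
    then show "(\<Sum>v\<in>e. x v) ^ k \<le> ?\<mu> * (\<Sum>v\<in>e. B v e * x v ^ k)"
      by (intro edge_weights.incidence_Q_edge_bound(1) [OF W s])
  next
    fix e u w and x :: "nat \<Rightarrow> real"
    assume "e \<in> E" "\<And>v. 0 \<le> x v" "u \<in> e" "x u = 0" "w \<in> e" "0 < x w"
    then show "(\<Sum>v\<in>e. x v) ^ k < ?\<mu> * (\<Sum>v\<in>e. B v e * x v ^ k)"
      by (intro edge_weights.incidence_Q_edge_bound(2) [OF W s])
  next
    fix e u w and x :: "nat \<Rightarrow> real"
    assume "e \<in> E" and x: "\<And>v. v \<in> e \<Longrightarrow> 0 < x v"
      and "u \<in> e" "w \<in> e" "u \<noteq> w" "B u e < 1" "B w e < 1"
    then show "(\<Sum>v\<in>e. x v) ^ k < ?\<mu> * (\<Sum>v\<in>e. B v e * x v ^ k)"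
      by (intro edge_weights.incidence_Q_edge_bound(3) [OF W s less_imp_le [OF x]])
  next
    fix c assume c: "c \<in> {1..n}" "\<forall>e\<in>E. c \<in> e" and n: "n = card E * (k - 1) + 1"
    let ?y = "\<lambda>v. if v = c then s else 1"
    obtain p where p: "k = Suc p" using k by (cases k) auto
    have "(\<Sum>v\<in>{1..n}. ?y v ^ k) = real m * (s + real k - 1)"
      using sum_centre [of "{1..n}" c "\<lambda>t. t ^ k" s] c(1) s(2)
      by (simp add: n m(1) p algebra_simps)
    moreover have "(\<Sum>v\<in>e. ?y v) = s + real k - 1" if "e \<in> E" for e
      using sum_centre [OF T'(5) [OF that], of c "\<lambda>t. t" s] c(2) that by (simp add: T'(4))
    then have "(\<Sum>e\<in>E. (\<Sum>v\<in>e. ?y v) ^ k) = real m * (s + real k - 1) ^ k"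
      by (simp add: m(1))
    ultimately have "(\<Sum>e\<in>E. (\<Sum>v\<in>e. ?y v) ^ k) = ?\<mu> * (\<Sum>v\<in>{1..n}. ?y v ^ k)"
      by (simp add: p mult_ac)
    then show "\<exists>y. (\<forall>v. 0 < y v) \<and>
        (\<Sum>e\<in>E. (\<Sum>v\<in>e. y v) ^ k) = ?\<mu> * (\<Sum>v\<in>{1..n}. y v ^ k)"
      using s(1) by (intro exI [of _ ?y]) simp
  qed
qed

theorem theorem1:
  fixes k n m :: nat and E :: "nat set set"
  assumes "k \<ge> 2"
    and "supertree n k E"
    and "card E = m"
    and "m \<ge> 1"
  shows "spectral_radius k n (adjacency_tensor k E) \<le> real m powr (1 / real k)
      \<and> (spectral_radius k n (adjacency_tensor k E) = real m powr (1 / real k)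
           \<longleftrightarrow> (\<exists>S. hyperstar n k m S \<and> hypergraph_isomorphic n E n S))
      \<and> (\<exists>\<alpha>::real. \<alpha> ^ k - (real m - 1) * \<alpha> ^ (k - 1) - real m = 0
           \<and> (\<forall>x::real. x ^ k - (real m - 1) * x ^ (k - 1) - real m = 0 \<longrightarrow> x \<le> \<alpha>)
           \<and> real m - 1 < \<alpha> \<and> \<alpha> \<le> real m
           \<and> spectral_radius k n (signless_laplacian_tensor k E) \<le> 1 + \<alpha>
           \<and> (spectral_radius k n (signless_laplacian_tensor k E) = 1 + \<alpha>
                \<longleftrightarrow> (\<exists>S. hyperstar n k m S \<and> hypergraph_isomorphic n E n S)))
      \<and> spectral_radius k n (incidence_Q_tensor E)
           \<le> (real m powr (1 / (real k - 1)) + real k - 1) ^ (k - 1)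
      \<and> (spectral_radius k n (incidence_Q_tensor E)
             = (real m powr (1 / (real k - 1)) + real k - 1) ^ (k - 1)
           \<longleftrightarrow> (\<exists>S. hyperstar n k m S \<and> hypergraph_isomorphic n E n S))"
proof -
  note tree = assms(1-4)
  have k1: "k \<ge> 1" using assms(1) by simp
  have star: "(\<exists>S. hyperstar n k m S \<and> hypergraph_isomorphic n E n S)
      \<longleftrightarrow> (\<exists>c\<in>{1..n}. \<forall>e\<in>E. c \<in> e)"
    using isomorphic_hyperstar_iff [OF assms(2) k1 assms(3,4)] .
  have "0 < real m powr (1 / real k)" "(real m powr (1 / real k)) ^ k = real m"
    using assms(1,4) by (simp_all add: powr_powr flip: powr_realpow)
  note A = adjacency_spectral_radius_bound [OF tree this]
  have "0 < real m powr (1 / (real k - 1))" "(real m powr (1 / (real k - 1))) ^ (k - 1) = real m"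
    using assms(1,4) by (simp_all add: powr_powr of_nat_diff flip: powr_realpow)
  note Q' = incidence_Q_spectral_radius_bound [OF tree this]
  obtain \<alpha> where \<alpha>: "\<alpha> ^ k - (real m - 1) * \<alpha> ^ (k - 1) - real m = 0"
    "\<And>x. x ^ k - (real m - 1) * x ^ (k - 1) - real m = 0 \<Longrightarrow> x \<le> \<alpha>"
    "real m - 1 < \<alpha>" "\<alpha> \<le> real m"
    using signless_laplacian_root [OF assms(1), of "real m"] assms(4) by auto
  have "0 < \<alpha>" "\<alpha> ^ k - (real m - 1) * \<alpha> ^ (k - 1) = real m"
    using \<alpha>(1,3) assms(4) by auto
  note Q = signless_laplacian_spectral_radius_bound [OF tree this]
  show ?thesis
    unfolding star
    by (intro conjI exI [of _ \<alpha>] allI impI A [THEN conjunct1] A [THEN conjunct2]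
        Q [THEN conjunct1] Q [THEN conjunct2] Q' [THEN conjunct1] Q' [THEN conjunct2] \<alpha>)
qed

end
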